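(* Let $\Sigma$ be the compact genus-three hyperelliptic Riemann surface of $y^2=\omega^8-14\omega^4+1$, let $\lambda\in\mathbb{C}$, and let $$\Phi_1=\frac{1-(1+\lambda^2)\omega^2}{y}\,d\omega,\quad \Phi_2=\frac{i\,(1+(1+\lambda^2)\omega^2)}{y}\,d\omega,\quad \Phi_3=\frac{2\omega}{y}\,d\omega,\quad \Phi_4=\frac{2\lambda\omega}{y}\,d\omega$$ be the associated holomorphic $1$-forms on $\Sigma$. Let $\sigma:\Sigma\to\Sigma$ be the order-four automorphism $\sigma(\omega,y)=(i\omega,y)$, and let $\mathcal{P}:H_1(\Sigma;\mathbb{Z})\to\mathbb{R}^4$, $\mathcal{P}([\gamma])=\Re\int_\gamma(\Phi_1,\Phi_2,\Phi_3,\Phi_4)$. Then for every $[\gamma]\in H_1(\Sigma;\mathbb{Z})$, $$\Re\int_{\sigma(\gamma)}\Phi_1=\Re\int_\gamma\Phi_2,\qquad \Re\int_{\sigma(\gamma)}\Phi_2=-\Re\int_\gamma\Phi_1,$$ $$\Re\int_{\sigma(\gamma)}\Phi_3=-\Re\int_\gamma\Phi_3,\qquad \Re\int_{\sigma(\gamma)}\Phi_4=-\Re\int_\gamma\Phi_4.$$ In particular, if $\Gamma\subset H_1(\Sigma;\mathbb{Z})$ is a set of homology classes which generates $H_1(\Sigma;\mathbb{Z})$ and is closed under the action of $\sigma_*$, then for any choice of representatives of the $\sigma_*$-orbits in $\Gamma$, the real period vectors $\mathcal{P}([\gamma])$ for all $[\gamma]\in\Gamma$ are determined by the real period vectors of the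 chosen representatives via the identities $\Re\int_{\sigma(\gamma)}\Phi_1=\Re\int_\gamma\Phi_2$, $\Re\int_{\sigma(\gamma)}\Phi_2=-\Re\int_\gamma\Phi_1$, $\Re\int_{\sigma(\gamma)}\Phi_3=-\Re\int_\gamma\Phi_3$, $\Re\int_{\sigma(\gamma)}\Phi_4=-\Re\int_\gamma\Phi_4$ and their iterates; that is, if $[\gamma]=\sigma_*^k[\gamma_0]$ with $[\gamma_0]$ a chosen representative and $k\ge 0$, then $\mathcal{P}([\gamma])=R^k\,\mathcal{P}([\gamma_0])$, where $R(x_1,x_2,x_3,x_4)=(x_2,-x_1,-x_3,-x_4)$.
   Context: $\Sigma$ denotes the compactification (smooth projective model) of the affine curve $\{(\omega,y)\in\mathbb{C}^2: y^2=\omega^8-14\omega^4+1\}$; since the polynomial has degree $8$ and simple roots, $\Sigma$ has genus $3$. The automorphism $\sigma$ is defined on the affine curve by the given formula (well defined because $\omega^8-14\omega^4+1$ is invariant under $\omega\mapsto i\omega$) and extends to $\Sigma$. The forms $\Phi_j$ arise from the Weierstrass data $f=2/y$, $g_1=\omega$, $g_2=\lambda\omega$ via $\Phi_1=\tfrac12 f(1-g_1^2-g_2^2)\,d\omega$, $\Phi_2=\tfrac i2 f(1+g_1^2+g_2^2)\,d\omega$, $\Phi_3=fg_1\,d\omega$, $\Phi_4=fg_2\,d\omega$. $\sigma_*$ denotes the induced action on $H_1(\Sigma;\mathbb{Z})$, so $\sigma_*[\gamma]=[\sigma(\gamma)]$. *)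

theory Defs
  imports "HOL-Complex_Analysis.Complex_Analysis" "HOL-Homology.Homology" "HOL-Algebra.Generated_Groups"
begin

section \<open>One-forms on Riemann surfaces and their integrals over singular chains\<close>

text \<open>A Riemann surface is given by a topology \<open>X\<close> together with an atlas, i.e. a set of pairs
  \<open>(U, z)\<close> consisting of a coordinate domain and a coordinate function that is injective on it.
  A one-form \<open>\<Phi>\<close> is given by its coefficients: \<open>\<Phi> (U, z) p\<close> is the coefficient of \<open>dz\<close> at the
  point \<open>p\<close> of \<open>U\<close>.\<close>

type_synonym 'a chart = "'a set \<times> ('a \<Rightarrow> complex)"
type_synonym 'a one_form = "'a chart \<Rightarrow> 'a \<Rightarrow> complex"

text \<open>The one-form \<open>g df\<close>.  In a chart \<open>z\<close> its coefficient is \<open>g df/dz\<close>; taking the limit over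
  punctured neighbourhoods extends this across the isolated points where \<open>g\<close> or \<open>f\<close> has a pole
  (so the values given to \<open>g\<close> and \<open>f\<close> at such points do not matter).\<close>

definition form_times_d :: "('a \<Rightarrow> complex) \<Rightarrow> ('a \<Rightarrow> complex) \<Rightarrow> 'a one_form" where
  "form_times_d g f = (\<lambda>(U, z) p.
     Lim (at (z p)) (\<lambda>w. g (inv_into U z w) * deriv (f \<circ> inv_into U z) w))"

text \<open>\<open>h\<close> is a holomorphic function on the open set \<open>U\<close> with \<open>dh = \<Phi>\<close>.\<close>

definition local_primitive ::
    "'a topology \<Rightarrow> 'a chart set \<Rightarrow> 'a one_form \<Rightarrow> 'a set \<Rightarrow> ('a \<Rightarrow> complex) \<Rightarrow> bool" where
  "local_primitive X \<A> \<Phi> U h \<longleftrightarrow> openin X U \<and>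
     (\<forall>(V, z) \<in> \<A>. \<forall>p \<in> U \<inter> V.
        ((h \<circ> inv_into V z) has_field_derivative \<Phi> (V, z) p) (at (z p)))"

text \<open>Integral of a closed one-form along a merely continuous path \<open>c\<close> on \<open>[0,1]\<close>:  the increment of
  a function \<open>F\<close> on \<open>[0,1]\<close> that near every parameter is the pullback along \<open>c\<close> of a local
  primitive.  For piecewise smooth \<open>c\<close> this is the usual line integral.\<close>

definition has_path_integral ::
    "'a topology \<Rightarrow> 'a chart set \<Rightarrow> 'a one_form \<Rightarrow> (real \<Rightarrow> 'a) \<Rightarrow> complex \<Rightarrow> bool" where
  "has_path_integral X \<A> \<Phi> c I \<longleftrightarrow>
     (\<exists>F :: real \<Rightarrow> complex. I = F 1 - F 0 \<and>
       (\<forall>t \<in> {0..1}. \<exists>U h e. local_primitive X \<A> \<Phi> U h \<and> e > 0 \<and>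
          (\<forall>s \<in> {0..1}. \<bar>s - t\<bar> < e \<longrightarrow> c s \<in> U \<and> F s = h (c s))))"

definition path_integral_form ::
    "'a topology \<Rightarrow> 'a chart set \<Rightarrow> 'a one_form \<Rightarrow> (real \<Rightarrow> 'a) \<Rightarrow> complex" where
  "path_integral_form X \<A> \<Phi> c = (THE I. has_path_integral X \<A> \<Phi> c I)"

text \<open>A singular 1-simplex is a map on the standard simplex in barycentric coordinates; it is
  traversed from vertex 0 to vertex 1, in agreement with \<^const>\<open>chain_boundary\<close>.\<close>

definition simplex_path :: "((nat \<Rightarrow> real) \<Rightarrow> 'a) \<Rightarrow> real \<Rightarrow> 'a" where
  "simplex_path s t = s (\<lambda>i. if i = 0 then 1 - t else if i = 1 then t else 0)"

definition chain_integral ::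
    "'a topology \<Rightarrow> 'a chart set \<Rightarrow> 'a one_form \<Rightarrow> 'a chain \<Rightarrow> complex" where
  "chain_integral X \<A> \<Phi> \<gamma> =
     (\<Sum>s \<in> Poly_Mapping.keys \<gamma>.
        of_int (Poly_Mapping.lookup \<gamma> s) * path_integral_form X \<A> \<Phi> (simplex_path s))"

text \<open>A homology class is the set of its representing cycles; its period is the common value of
  the integrals over all of them.\<close>

definition class_integral ::
    "'a topology \<Rightarrow> 'a chart set \<Rightarrow> 'a one_form \<Rightarrow> 'a chain set \<Rightarrow> complex" where
  "class_integral X \<A> \<Phi> C = (THE I. \<forall>\<gamma> \<in> C. chain_integral X \<A> \<Phi> \<gamma> = I)"


section \<open>The hyperelliptic surface\<close>

text \<open>The affine curve \<open>y\<^sup>2 = \<omega>\<^sup>8 - 14 \<omega>\<^sup>4 + 1\<close>.  With \<open>u = 1/\<omega>\<close> and \<open>v = y/\<omega>\<^sup>4\<close> the curve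
  becomes \<open>v\<^sup>2 = u\<^sup>8 - 14 u\<^sup>4 + 1\<close>, the same equation since the polynomial is palindromic.  The
  smooth projective model is the union of these two affine curves, glued along \<open>\<omega> \<noteq> 0\<close> and
  \<open>u \<noteq> 0\<close>; it has the two additional points \<open>(u, v) = (0, \<plusminus>1)\<close>, written \<open>Infty v\<close>.\<close>

definition affine_curve :: "(complex \<times> complex) set" where
  "affine_curve = {(w, y). y ^ 2 = w ^ 8 - 14 * w ^ 4 + 1}"

datatype curve_point = Aff complex complex | Infty complex

fun patch_zero :: "complex \<times> complex \<Rightarrow> curve_point" where
  "patch_zero (w, y) = Aff w y"

fun patch_inf :: "complex \<times> complex \<Rightarrow> curve_point" where
  "patch_inf (u, v) = (if u = 0 then Infty v else Aff (1 / u) (v / u ^ 4))"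

definition Sigma_open :: "curve_point set \<Rightarrow> bool" where
  "Sigma_open U \<longleftrightarrow> U \<subseteq> patch_zero ` affine_curve \<union> patch_inf ` affine_curve \<and>
     openin (top_of_set affine_curve) {q \<in> affine_curve. patch_zero q \<in> U} \<and>
     openin (top_of_set affine_curve) {q \<in> affine_curve. patch_inf q \<in> U}"

definition Sigma_surf :: "curve_point topology" where
  "Sigma_surf = topology Sigma_open"

text \<open>The values of the following functions at their poles (among the points at infinity for
  \<open>\<omega>\<close> and \<open>y\<close>, at \<open>\<omega> = 0\<close> for \<open>u\<close>) are irrelevant.\<close>

fun omega_fun :: "curve_point \<Rightarrow> complex" where
  "omega_fun (Aff w y) = w"
| "omega_fun (Infty v) = 0"

fun y_fun :: "curve_point \<Rightarrow> complex" where
  "y_fun (Aff w y) = y"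
| "y_fun (Infty v) = 0"

fun u_fun :: "curve_point \<Rightarrow> complex" where
  "u_fun (Aff w y) = 1 / w"
| "u_fun (Infty v) = 0"

text \<open>The complex structure: \<open>\<omega>\<close> is a local coordinate where \<open>y \<noteq> 0\<close>, \<open>y\<close> is one where the
  derivative \<open>8 \<omega>\<^sup>7 - 56 \<omega>\<^sup>3\<close> of the polynomial does not vanish (in particular at the branch
  points), and \<open>u = 1/\<omega>\<close> is one near infinity.\<close>

definition Sigma_atlas :: "curve_point chart set" where
  "Sigma_atlas =
     {(U, omega_fun) | U. openin Sigma_surf U \<and> inj_on omega_fun U \<and>
        U \<subseteq> {Aff w y | w y. y \<noteq> 0}} \<union>
     {(U, y_fun) | U. openin Sigma_surf U \<and> inj_on y_fun U \<and>
        U \<subseteq> {Aff w y | w y. 8 * w ^ 7 - 56 * w ^ 3 \<noteq> 0}} \<union>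
     {(U, u_fun) | U. openin Sigma_surf U \<and> inj_on u_fun U \<and>
        U \<subseteq> {Aff w y | w y. w \<noteq> 0 \<and> y \<noteq> 0} \<union> range Infty}"

lemma istopology_Sigma_open: "istopology Sigma_open"
proof -
  have inter: "Sigma_open (S \<inter> T)" if "Sigma_open S" "Sigma_open T" for S T
  proof -
    have "{q \<in> affine_curve. f q \<in> S \<inter> T} = {q \<in> affine_curve. f q \<in> S} \<inter> {q \<in> affine_curve. f q \<in> T}"
      for f :: "complex \<times> complex \<Rightarrow> curve_point" by blast
    with that show ?thesis unfolding Sigma_open_def by (auto intro: openin_Int)
  qed
  have union: "Sigma_open (\<Union>K)" if "\<forall>S\<in>K. Sigma_open S" for K
  proof -
    have "{q \<in> affine_curve. f q \<in> \<Union>K} = (\<Union>S\<in>K. {q \<in> affine_curve. f q \<in> S})"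
      for f :: "complex \<times> complex \<Rightarrow> curve_point" by blast
    with that show ?thesis unfolding Sigma_open_def by (auto intro!: openin_Union)
  qed
  from inter union show ?thesis unfolding istopology_def by blast
qed

lemma openin_Sigma_surf: "openin Sigma_surf U \<longleftrightarrow> Sigma_open U"
  unfolding Sigma_surf_def using istopology_Sigma_open by (simp add: topology_inverse')

text \<open>The automorphism \<open>(\<omega>, y) \<mapsto> (i \<omega>, y)\<close>; in the patch at infinity it is
  \<open>(u, v) \<mapsto> (- i u, v)\<close>.\<close>

fun sigma_aut :: "curve_point \<Rightarrow> curve_point" where
  "sigma_aut (Aff w y) = Aff (\<i> * w) y"
| "sigma_aut (Infty v) = Infty v"

lemma sigma_aut_patch_zero: "sigma_aut (patch_zero (w, y)) = patch_zero (\<i> * w, y)"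
  by simp

lemma sigma_aut_patch_inf: "sigma_aut (patch_inf (u, v)) = patch_inf (- \<i> * u, v)"
  by (simp add: power_mult_distrib field_simps)

lemma sigma_aut_order_4: "(sigma_aut ^^ 4) p = p"
  by (cases p) (simp_all add: numeral_eq_Suc mult.assoc [symmetric])

lemma topspace_Sigma_surf:
  "topspace Sigma_surf = patch_zero ` affine_curve \<union> patch_inf ` affine_curve"
proof -
  have "Sigma_open (patch_zero ` affine_curve \<union> patch_inf ` affine_curve)"
  proof -
    have "{q \<in> affine_curve. f q \<in> patch_zero ` affine_curve \<union> patch_inf ` affine_curve} = affine_curve"
      if "f = patch_zero \<or> f = patch_inf" for f using that by auto
    then show ?thesis unfolding Sigma_open_def by (simp add: openin_subtopology_self)
  qed
  then show ?thesis
    unfolding topspace_def openin_Sigma_surf Sigma_open_def by blast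
qed

lemma continuous_map_sigma_aut: "continuous_map Sigma_surf Sigma_surf sigma_aut"
proof -
  let ?T = "topspace Sigma_surf"
  have r: "(\<i> * w, y) \<in> affine_curve" "(- \<i> * w, y) \<in> affine_curve" if "(w, y) \<in> affine_curve" for w y
  proof -
    have e: "\<i> ^ 8 = 1" "\<i> ^ 4 = 1" by (simp_all add: numeral_eq_Suc)
    show "(\<i> * w, y) \<in> affine_curve" "(- \<i> * w, y) \<in> affine_curve"
      using that by (simp_all add: affine_curve_def power_mult_distrib e)
  qed
  have maps: "sigma_aut p \<in> ?T" if "p \<in> ?T" for p
    using that r unfolding topspace_Sigma_surf
    by (fastforce simp: sigma_aut_patch_zero sigma_aut_patch_inf simp del: patch_zero.simps patch_inf.simps)
  have pre: "openin (top_of_set affine_curve) {q \<in> affine_curve. (c * fst q, snd q) \<in> V}"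
    if V: "openin (top_of_set affine_curve) V" and c: "c = \<i> \<or> c = - \<i>" for c V
  proof -
    have "continuous_on affine_curve (\<lambda>q. (c * fst q, snd q))" by (intro continuous_intros)
    moreover have "(\<lambda>q. (c * fst q, snd q)) \<in> affine_curve \<rightarrow> affine_curve"
      using r c by auto
    ultimately have "openin (top_of_set affine_curve) (affine_curve \<inter> (\<lambda>q. (c * fst q, snd q)) -` V)"
      using V continuous_openin_preimage by blast
    then show ?thesis by (simp add: vimage_def Int_def)
  qed
  have "openin Sigma_surf {p \<in> ?T. sigma_aut p \<in> U}" if U: "openin Sigma_surf U" for U
  proof -
    have mem: "patch_zero q \<in> ?T" "patch_inf q \<in> ?T" if "q \<in> affine_curve" for q
      using that unfolding topspace_Sigma_surf by blast+
    have eqs: "sigma_aut (patch_zero q) = patch_zero (\<i> * fst q, snd q)"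
         "sigma_aut (patch_inf q) = patch_inf (- \<i> * fst q, snd q)" for q
      using sigma_aut_patch_zero sigma_aut_patch_inf by (cases q; simp only: fst_conv snd_conv)+
    have inv: "(\<i> * fst q, snd q) \<in> affine_curve" "(- \<i> * fst q, snd q) \<in> affine_curve"
      if "q \<in> affine_curve" for q
      using r[of "fst q" "snd q"] that by simp_all
    have "{q \<in> affine_curve. patch_zero q \<in> {p \<in> ?T. sigma_aut p \<in> U}} =
      {q \<in> affine_curve. (\<i> * fst q, snd q) \<in> {q \<in> affine_curve. patch_zero q \<in> U}}"
      using mem inv(1) by (auto simp only: eqs mem_Collect_eq)
    moreover have "{q \<in> affine_curve. patch_inf q \<in> {p \<in> ?T. sigma_aut p \<in> U}} =
      {q \<in> affine_curve. (- \<i> * fst q, snd q) \<in> {q \<in> affine_curve. patch_inf q \<in> U}}"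
      using mem inv(2) by (auto simp only: eqs mem_Collect_eq)
    moreover have "{p \<in> ?T. sigma_aut p \<in> U} \<subseteq> patch_zero ` affine_curve \<union> patch_inf ` affine_curve"
      by (auto simp only: topspace_Sigma_surf)
    ultimately show ?thesis
      using U pre by (simp only: openin_Sigma_surf Sigma_open_def) blast
  qed
  with maps show ?thesis by (auto simp: continuous_map_def)
qed


section \<open>Forms, homology and periods\<close>

definition Phi1 :: "complex \<Rightarrow> curve_point one_form" where
  "Phi1 lam = form_times_d (\<lambda>p. (1 - (1 + lam ^ 2) * omega_fun p ^ 2) / y_fun p) omega_fun"

definition Phi2 :: "complex \<Rightarrow> curve_point one_form" where
  "Phi2 lam = form_times_d (\<lambda>p. \<i> * (1 + (1 + lam ^ 2) * omega_fun p ^ 2) / y_fun p) omega_fun"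

definition Phi3 :: "curve_point one_form" where
  "Phi3 = form_times_d (\<lambda>p. 2 * omega_fun p / y_fun p) omega_fun"

definition Phi4 :: "complex \<Rightarrow> curve_point one_form" where
  "Phi4 lam = form_times_d (\<lambda>p. 2 * lam * omega_fun p / y_fun p) omega_fun"

abbreviation H1_Sigma :: "curve_point chain set monoid" where
  "H1_Sigma \<equiv> homology_group 1 Sigma_surf"

abbreviation homology_class :: "curve_point chain \<Rightarrow> curve_point chain set" where
  "homology_class \<gamma> \<equiv> homologous_rel_set 1 Sigma_surf {} \<gamma>"

abbreviation sigma_star :: "curve_point chain set \<Rightarrow> curve_point chain set" where
  "sigma_star \<equiv> hom_induced 1 Sigma_surf {} Sigma_surf {} sigma_aut"

definition Re_int :: "curve_point chain \<Rightarrow> curve_point one_form \<Rightarrow> real" where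
  "Re_int \<gamma> \<Phi> = Re (chain_integral Sigma_surf Sigma_atlas \<Phi> \<gamma>)"

definition period_map :: "complex \<Rightarrow> curve_point chain set \<Rightarrow> real ^ 4" where
  "period_map lam C = vector
     (map (\<lambda>\<Phi>. Re (class_integral Sigma_surf Sigma_atlas \<Phi> C)) [Phi1 lam, Phi2 lam, Phi3, Phi4 lam])"

definition R_map :: "real ^ 4 \<Rightarrow> real ^ 4" where
  "R_map x = vector [x $ 2, - x $ 1, - x $ 3, - x $ 4]"

text \<open>Since \<open>\<sigma>\<close> has order four, the forward iterates already form the full orbit.\<close>

definition sigma_orbit :: "curve_point chain set \<Rightarrow> curve_point chain set set" where
  "sigma_orbit C = {(sigma_star ^^ k) C | k. True}"

definition orbit_representatives ::
    "curve_point chain set set \<Rightarrow> curve_point chain set set \<Rightarrow> bool" where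
  "orbit_representatives \<Gamma> T \<longleftrightarrow> T \<subseteq> \<Gamma> \<and> (\<forall>C \<in> \<Gamma>. \<exists>!C0. C0 \<in> T \<and> C0 \<in> sigma_orbit C)"

end

(* The integral of a closed one-form over a singular simplex is the increment of a function on
   the simplex that is locally the pullback of a local primitive.  Such functions are unique up to
   constants and exist on every compact convex plane set, hence the integral over the boundary of
   a singular 2-simplex vanishes and periods depend only on the homology class.

   The forms Phi_j are all of the shape (a + b w + c w^2) dw / y.  Pulling back by the automorphism
   (w, y) -> (i w, y) turns the coefficients (a, b, c) into (i a, - b, - i c); this exchanges Phi_1
   and Phi_2 up to sign and negates Phi_3 and Phi_4. *)

theory Submission
  imports Defs
begin

section \<open>Primitives along maps\<close>

text \<open>Singular simplices are only continuous, so an integral cannot be computed from the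
  derivative of a path; increments of primitives replace it throughout. The obstacle on the curve is
  that \<open>local_primitive\<close> tests a function in every chart of the atlas, and the atlas
  contains all suitable open sets with coordinate \<omega>, y or u = 1/\<omega>. A primitive found
  in one coordinate has to be verified in the others as well. This stays manageable because a branch
  point lies only in y-charts and a point at infinity only in u-charts, while at every remaining
  point all three coordinates can be compared with \<omega>.

  The automorphism is handled on primitives instead of forms: if the pullback of \<Phi> is k times
  \<Psi>, a primitive h of \<Psi> yields the primitive k h \<circ> \<sigma>^(-1) of \<Phi>. The
  resulting identities already hold for the complex integrals, with k = 1 or k = -1; real parts are
  taken only afterwards.\<close>

definition pullback_primitive ::
    "'a topology \<Rightarrow> 'a chart set \<Rightarrow> 'a one_form \<Rightarrow> 'b::metric_space set \<Rightarrow> ('b \<Rightarrow> 'a) \<Rightarrow> ('b \<Rightarrow> complex) \<Rightarrow> bool" where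
  "pullback_primitive X \<A> \<Phi> T g F \<longleftrightarrow>
     (\<forall>t\<in>T. \<exists>U h. local_primitive X \<A> \<Phi> U h \<and>
        (\<forall>\<^sub>F s in nhds t. s \<in> T \<longrightarrow> g s \<in> U \<and> F s = h (g s)))"

text \<open>Paths are the case \<open>T = {0..1}\<close> of a notion that makes sense over any
  metric space. The generality is needed because a triangle in the plane plays the role of
  \<open>T\<close> when boundaries are integrated.\<close>

lemma has_path_integral_iff:
  "has_path_integral X \<A> \<Phi> c I \<longleftrightarrow> (\<exists>F. I = F 1 - F 0 \<and> pullback_primitive X \<A> \<Phi> {0..1} c F)"
proof -
  have "(\<exists>U h e. local_primitive X \<A> \<Phi> U h \<and> e > 0 \<and> (\<forall>s\<in>{0..1}. \<bar>s - t\<bar> < e \<longrightarrow> c s \<in> U \<and> F s = h (c s))) \<longleftrightarrow>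
      (\<exists>U h. local_primitive X \<A> \<Phi> U h \<and> (\<forall>\<^sub>F s in nhds t. s \<in> {0..1} \<longrightarrow> c s \<in> U \<and> F s = h (c s)))"
    for t :: real and F
    unfolding eventually_nhds_metric dist_real_def by blast
  then show ?thesis
    unfolding has_path_integral_def pullback_primitive_def by simp
qed

text \<open>Serves for restriction to a subset, for passing from a triangle to its edges, and for
  moving between a real interval and a complex segment. The map \<open>c\<close> has to agree with
  \<open>g \<circ> k\<close> on \<open>S\<close> only, since singular simplices are controlled only
  on the standard simplex.\<close>

lemma pullback_primitive_compose:
  assumes F: "pullback_primitive X \<A> \<Phi> T g F" and k: "continuous_on S k" "k ` S \<subseteq> T"
    and c: "\<And>s. s \<in> S \<Longrightarrow> c s = g (k s)"
  shows "pullback_primitive X \<A> \<Phi> S c (F \<circ> k)"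
  unfolding pullback_primitive_def
proof
  fix t assume t: "t \<in> S"
  then obtain U h where U: "local_primitive X \<A> \<Phi> U h"
      "\<forall>\<^sub>F s in nhds (k t). s \<in> T \<longrightarrow> g s \<in> U \<and> F s = h (g s)"
    using F k(2) unfolding pullback_primitive_def by blast
  have "(k \<longlongrightarrow> k t) (at t within S)"
    using k(1) t by (simp add: continuous_on_def)
  then have "\<forall>\<^sub>F s in at t within S. k s \<in> T \<longrightarrow> g (k s) \<in> U \<and> F (k s) = h (g (k s))"
    using U(2) unfolding filterlim_iff by blast
  then have ev: "\<forall>\<^sub>F s in nhds t. s \<noteq> t \<longrightarrow> s \<in> S \<longrightarrow> k s \<in> T \<longrightarrow> g (k s) \<in> U \<and> F (k s) = h (g (k s))"
    by (simp add: eventually_at_filter)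
  \<comment> \<open>Continuity of \<open>k\<close> on \<open>S\<close> is a limit at
    \<open>t\<close> that excludes \<open>t\<close> itself, so the value at \<open>t\<close> is
    supplied separately.\<close>
  have at_t: "g (k t) \<in> U \<and> F (k t) = h (g (k t))"
    using eventually_nhds_x_imp_x[OF U(2)] t k(2) by blast
  have "g (k s) \<in> U \<and> F (k s) = h (g (k s))"
    if "s \<noteq> t \<longrightarrow> s \<in> S \<longrightarrow> k s \<in> T \<longrightarrow> g (k s) \<in> U \<and> F (k s) = h (g (k s))" "s \<in> S" for s
    using that at_t k(2) by (cases "s = t") auto
  then have "\<forall>\<^sub>F s in nhds t. s \<in> S \<longrightarrow> c s \<in> U \<and> (F \<circ> k) s = h (c s)"
    using ev by (elim eventually_mono) (metis c comp_apply)
  then show "\<exists>U h. local_primitive X \<A> \<Phi> U h \<and> (\<forall>\<^sub>F s in nhds t. s \<in> S \<longrightarrow> c s \<in> U \<and> (F \<circ> k) s = h (c s))"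
    using U(1) by blast
qed

lemma pullback_primitive_subset:
  assumes "pullback_primitive X \<A> \<Phi> T g F" "S \<subseteq> T"
  shows "pullback_primitive X \<A> \<Phi> S g F"
  using pullback_primitive_compose[OF assms(1) continuous_on_id, of S g] assms(2) by (simp add: o_def)

lemma local_primitive_add_const:
  assumes "local_primitive X \<A> \<Phi> U h"
  shows "local_primitive X \<A> \<Phi> U (\<lambda>p. h p + k)"
proof -
  have "((\<lambda>p. h p + k) \<circ> f has_field_derivative D) (at x)" if "(h \<circ> f has_field_derivative D) (at x)" for f D x
    using DERIV_add[OF that DERIV_const[of k]] by (simp add: o_def)
  then show ?thesis using assms unfolding local_primitive_def by blast
qed

lemma continuous_map_eventually_nhds:
  assumes "continuous_map (top_of_set T) X g" "openin X W" "t \<in> T" "g t \<in> W"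
  shows "\<forall>\<^sub>F s in nhds t. s \<in> T \<longrightarrow> g s \<in> W"
proof -
  have "openin (top_of_set T) {s \<in> T. g s \<in> W}"
    using assms(1,2) unfolding continuous_map_def by simp
  then obtain S where "open S" "{s \<in> T. g s \<in> W} = T \<inter> S"
    unfolding openin_open by blast
  then show ?thesis
    using assms(3,4) unfolding eventually_nhds by blast
qed

text \<open>These two properties are all that integration over chains needs: primitives exist near
  every point, and two of them differ by a local constant. The calculus on the curve enters only
  when the locale is instantiated.\<close>

locale closed_form =
  fixes X :: "'a topology" and \<A> :: "'a chart set" and \<Phi> :: "'a one_form"
  assumes primitive_exists: "p \<in> topspace X \<Longrightarrow> \<exists>U h. local_primitive X \<A> \<Phi> U h \<and> p \<in> U"
    and primitive_unique: "\<lbrakk>local_primitive X \<A> \<Phi> U1 h1; local_primitive X \<A> \<Phi> U2 h2; p \<in> U1; p \<in> U2\<rbrakk>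
      \<Longrightarrow> \<exists>W. openin X W \<and> p \<in> W \<and> (\<forall>q\<in>W. h1 q - h2 q = h1 p - h2 p)"
begin

text \<open>Both functions are expressed through the same local primitive once \<open>F2\<close> is
  shifted by its offset at \<open>t\<close>. Two domains are allowed so that the lemma yields
  uniqueness (\<open>T1 = T2\<close>) as well as gluing along an overlap.\<close>

lemma pullback_primitives_differ_locally:
  assumes g: "continuous_map (top_of_set (T1 \<union> T2)) X g"
    and F1: "pullback_primitive X \<A> \<Phi> T1 g F1" and F2: "pullback_primitive X \<A> \<Phi> T2 g F2"
    and t: "t \<in> T1" "t \<in> T2"
  shows "\<exists>U h. local_primitive X \<A> \<Phi> U h \<and>
    (\<forall>\<^sub>F s in nhds t. (s \<in> T1 \<longrightarrow> g s \<in> U \<and> F1 s = h (g s)) \<and>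
       (s \<in> T2 \<longrightarrow> g s \<in> U \<and> F2 s + (F1 t - F2 t) = h (g s)))"
proof -
  obtain U1 h1 where U1: "local_primitive X \<A> \<Phi> U1 h1"
      "\<forall>\<^sub>F s in nhds t. s \<in> T1 \<longrightarrow> g s \<in> U1 \<and> F1 s = h1 (g s)"
    using F1 t unfolding pullback_primitive_def by blast
  obtain U2 h2 where U2: "local_primitive X \<A> \<Phi> U2 h2"
      "\<forall>\<^sub>F s in nhds t. s \<in> T2 \<longrightarrow> g s \<in> U2 \<and> F2 s = h2 (g s)"
    using F2 t unfolding pullback_primitive_def by blast
  note at_t = eventually_nhds_x_imp_x[OF U1(2)] eventually_nhds_x_imp_x[OF U2(2)]
  obtain W where W: "openin X W" "g t \<in> W" "\<forall>q\<in>W. h1 q - h2 q = h1 (g t) - h2 (g t)"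
    using primitive_unique[OF U1(1) U2(1)] at_t t by blast
  have evW: "\<forall>\<^sub>F s in nhds t. s \<in> T1 \<union> T2 \<longrightarrow> g s \<in> W"
    using continuous_map_eventually_nhds[OF g W(1)] t W(2) by blast
  have "openin X U1" using U1(1) unfolding local_primitive_def by blast
  \<comment> \<open>So far \<open>U1\<close> is known to contain \<open>g s\<close> only for
    \<open>s\<close> in \<open>T1\<close>; openness of \<open>U1\<close> and continuity of
    \<open>g\<close> give it for nearby \<open>s\<close> in \<open>T2\<close> too.\<close>
  then have evU: "\<forall>\<^sub>F s in nhds t. s \<in> T1 \<union> T2 \<longrightarrow> g s \<in> U1"
    using continuous_map_eventually_nhds[OF g] at_t t by blast
  have eqs: "h1 (g s) = h2 (g s) + (F1 t - F2 t)" if "g s \<in> W" for s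
    using W(3)[rule_format, OF that] at_t t by (simp add: algebra_simps)
  have "\<forall>\<^sub>F s in nhds t. (s \<in> T1 \<longrightarrow> g s \<in> U1 \<and> F1 s = h1 (g s)) \<and>
       (s \<in> T2 \<longrightarrow> g s \<in> U1 \<and> F2 s + (F1 t - F2 t) = h1 (g s))"
    using U1(2) U2(2) evW evU by eventually_elim (use eqs in auto)
  then show ?thesis using U1(1) by blast
qed

text \<open>The difference is locally constant, hence constant on a connected set.\<close>

lemma pullback_primitive_unique:
  assumes g: "continuous_map (top_of_set T) X g" and "connected T"
    and F1: "pullback_primitive X \<A> \<Phi> T g F1" and F2: "pullback_primitive X \<A> \<Phi> T g F2"
  shows "(\<lambda>s. F1 s - F2 s) constant_on T"
proof (rule locally_constant_imp_constant[OF \<open>connected T\<close>])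
  fix t assume t: "t \<in> T"
  have g': "continuous_map (top_of_set (T \<union> T)) X g" using g by simp
  obtain U h where "\<forall>\<^sub>F s in nhds t. (s \<in> T \<longrightarrow> g s \<in> U \<and> F1 s = h (g s)) \<and>
       (s \<in> T \<longrightarrow> g s \<in> U \<and> F2 s + (F1 t - F2 t) = h (g s))"
    using pullback_primitives_differ_locally[OF g' F1 F2 t t] by blast
  then have "\<forall>\<^sub>F s in nhds t. s \<in> T \<longrightarrow> F1 s - F2 s = F1 t - F2 t"
    by (rule eventually_mono) (metis add_diff_cancel_left')
  then obtain S where S: "open S" "t \<in> S" "\<forall>s\<in>S. s \<in> T \<longrightarrow> F1 s - F2 s = F1 t - F2 t"
    unfolding eventually_nhds by blast
  show "\<exists>V. openin (top_of_set T) V \<and> t \<in> V \<and> (\<forall>x\<in>V. F1 x - F2 x = F1 t - F2 t)"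
    using S t by (intro exI[of _ "T \<inter> S"] conjI openin_open_Int) blast+
qed

text \<open>On the connected overlap the two functions differ by a single constant, which is added
  to the second one. Closedness ensures that a point outside one piece has a neighbourhood missing
  that piece, so only points of the overlap require a comparison of primitives.\<close>

lemma pullback_primitive_glue:
  assumes g: "continuous_map (top_of_set (T1 \<union> T2)) X g"
    and clo: "closed T1" "closed T2" and conn: "connected (T1 \<inter> T2)"
    and F1: "pullback_primitive X \<A> \<Phi> T1 g F1" and F2: "pullback_primitive X \<A> \<Phi> T2 g F2"
  shows "\<exists>F. pullback_primitive X \<A> \<Phi> (T1 \<union> T2) g F"
proof -
  have sub: "pullback_primitive X \<A> \<Phi> (T1 \<inter> T2) g F1" "pullback_primitive X \<A> \<Phi> (T1 \<inter> T2) g F2"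
    using pullback_primitive_subset F1 F2 by blast+
  have "continuous_map (top_of_set (T1 \<inter> T2)) X g"
    using continuous_map_from_subtopology_mono[OF g] by blast
  from pullback_primitive_unique[OF this conn sub]
  obtain k where k: "\<And>s. s \<in> T1 \<inter> T2 \<Longrightarrow> F1 s - F2 s = k"
    unfolding constant_on_def by blast
  define F where "F s = (if s \<in> T1 then F1 s else F2 s + k)" for s
  have F_eq: "F s = F2 s + k" if "s \<in> T2" for s
    using k[of s] that by (auto simp: F_def)
  have "\<exists>U h. local_primitive X \<A> \<Phi> U h \<and> (\<forall>\<^sub>F s in nhds t. s \<in> T1 \<union> T2 \<longrightarrow> g s \<in> U \<and> F s = h (g s))"
    if t: "t \<in> T1 \<union> T2" for t
  proof -
    consider "t \<in> T1" "t \<notin> T2" | "t \<in> T2" "t \<notin> T1" | "t \<in> T1" "t \<in> T2" using t by blast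
    then show ?thesis
    proof cases
      case 1
      then obtain U h where U: "local_primitive X \<A> \<Phi> U h"
          "\<forall>\<^sub>F s in nhds t. s \<in> T1 \<longrightarrow> g s \<in> U \<and> F1 s = h (g s)"
        using F1 unfolding pullback_primitive_def by blast
      have "\<forall>\<^sub>F s in nhds t. s \<in> - T2"
        using 1 clo(2) by (intro eventually_nhds_in_open) auto
      with U(2) have "\<forall>\<^sub>F s in nhds t. s \<in> T1 \<union> T2 \<longrightarrow> g s \<in> U \<and> F s = h (g s)"
        by eventually_elim (auto simp: F_def)
      then show ?thesis using U(1) by blast
    next
      case 2
      then obtain U h where U: "local_primitive X \<A> \<Phi> U h"
          "\<forall>\<^sub>F s in nhds t. s \<in> T2 \<longrightarrow> g s \<in> U \<and> F2 s = h (g s)"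
        using F2 unfolding pullback_primitive_def by blast
      have "local_primitive X \<A> \<Phi> U (\<lambda>p. h p + k)"
        by (rule local_primitive_add_const[OF U(1)])
      moreover have "\<forall>\<^sub>F s in nhds t. s \<in> - T1"
        using 2 clo(1) by (intro eventually_nhds_in_open) auto
      with U(2) have "\<forall>\<^sub>F s in nhds t. s \<in> T1 \<union> T2 \<longrightarrow> g s \<in> U \<and> F s = h (g s) + k"
        by eventually_elim (auto simp: F_eq)
      ultimately show ?thesis by blast
    next
      case 3
      obtain U h where U: "local_primitive X \<A> \<Phi> U h"
        "\<forall>\<^sub>F s in nhds t. (s \<in> T1 \<longrightarrow> g s \<in> U \<and> F1 s = h (g s)) \<and>
           (s \<in> T2 \<longrightarrow> g s \<in> U \<and> F2 s + (F1 t - F2 t) = h (g s))"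
        using pullback_primitives_differ_locally[OF g F1 F2 3] by blast
      have "\<forall>\<^sub>F s in nhds t. s \<in> T1 \<union> T2 \<longrightarrow> g s \<in> U \<and> F s = h (g s)"
        using U(2) by eventually_elim (use k[of t] 3 F_eq in \<open>auto simp: F_def\<close>)
      then show ?thesis using U(1) by blast
    qed
  qed
  then show ?thesis unfolding pullback_primitive_def by blast
qed

text \<open>The bound \<open>e\<close> is a Lebesgue number for the cover of \<open>T\<close> by
  open sets that \<open>g\<close> maps into the domain of a single primitive \<open>h\<close>; on a
  small \<open>C\<close> the composition \<open>h \<circ> g\<close> then works.\<close>

lemma pullback_primitive_exists_small:
  fixes T :: "'b::metric_space set"
  assumes g: "continuous_map (top_of_set T) X g" and "compact T"
  obtains e where "e > 0" "\<And>C. \<lbrakk>C \<subseteq> T; \<forall>x\<in>C. \<forall>y\<in>C. dist x y < e\<rbrakk> \<Longrightarrow> \<exists>F. pullback_primitive X \<A> \<Phi> C g F"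
proof -
  define \<G> where "\<G> = {G. open G \<and> (\<exists>U h. local_primitive X \<A> \<Phi> U h \<and> g ` (T \<inter> G) \<subseteq> U)}"
  have "\<exists>G\<in>\<G>. t \<in> G" if t: "t \<in> T" for t
  proof -
    have "g t \<in> topspace X" using g t unfolding continuous_map_def by auto
    then obtain U h where U: "local_primitive X \<A> \<Phi> U h" "g t \<in> U"
      using primitive_exists by blast
    then have "openin X U" unfolding local_primitive_def by blast
    then have "\<forall>\<^sub>F s in nhds t. s \<in> T \<longrightarrow> g s \<in> U"
      using continuous_map_eventually_nhds[OF g] t U(2) by blast
    then show ?thesis using U(1) unfolding \<G>_def eventually_nhds by blast
  qed
  then have "T \<subseteq> \<Union>\<G>" by blast
  moreover have opn: "open G" if "G \<in> \<G>" for G using that unfolding \<G>_def by blast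
  ultimately obtain e where e: "0 < e" "\<And>x. x \<in> T \<Longrightarrow> \<exists>G\<in>\<G>. ball x e \<subseteq> G"
    using Heine_Borel_lemma[OF \<open>compact T\<close> _ opn] by blast
  show thesis
  proof
    fix C assume C: "C \<subseteq> T" "\<forall>x\<in>C. \<forall>y\<in>C. dist x y < e"
    show "\<exists>F. pullback_primitive X \<A> \<Phi> C g F"
    proof (cases "C = {}")
      case True
      then show ?thesis by (simp add: pullback_primitive_def)
    next
      case False
      then obtain x where x: "x \<in> C" by blast
      then obtain G where "G \<in> \<G>" "ball x e \<subseteq> G" using e(2) C(1) by blast
      moreover have "C \<subseteq> ball x e" using C x by auto
      ultimately obtain U h where U: "local_primitive X \<A> \<Phi> U h" "g ` C \<subseteq> U"
        using C(1) unfolding \<G>_def by blast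
      then have "pullback_primitive X \<A> \<Phi> C g (h \<circ> g)"
        unfolding pullback_primitive_def
        by (intro ballI exI[of _ U] exI[of _ h] conjI always_eventually) (use U in auto)
      then show ?thesis by blast
    qed
  qed (use e in auto)
qed

text \<open>A small piece of \<open>T\<close> is mapped into the domain of one local primitive; larger pieces are
  halved by a vertical and by a horizontal line, and the primitives of convex halves differ by a
  constant on their (convex) intersection.\<close>

lemma pullback_primitive_exists:
  fixes T :: "complex set"
  assumes g: "continuous_map (top_of_set T) X g" and "compact T" "convex T"
  shows "\<exists>F. pullback_primitive X \<A> \<Phi> T g F"
proof -
  obtain e where e: "e > 0"
      "\<And>C. \<lbrakk>C \<subseteq> T; \<forall>x\<in>C. \<forall>y\<in>C. dist x y < e\<rbrakk> \<Longrightarrow> \<exists>F. pullback_primitive X \<A> \<Phi> C g F"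
    using pullback_primitive_exists_small[OF g \<open>compact T\<close>] by metis
  define R where "R C d \<longleftrightarrow> (\<forall>x\<in>C. \<forall>y\<in>C. \<bar>Re x - Re y\<bar> \<le> d \<and> \<bar>Im x - Im y\<bar> \<le> d)" for C d
  have halves: "\<exists>F. pullback_primitive X \<A> \<Phi> C g F"
    if C: "C \<subseteq> T" "closed C" "convex C" and f: "bounded_linear f"
      and l: "\<exists>F. pullback_primitive X \<A> \<Phi> (C \<inter> {x. f x \<le> m}) g F"
      and r: "\<exists>F. pullback_primitive X \<A> \<Phi> (C \<inter> {x. f x \<ge> m}) g F"
    for C and f :: "complex \<Rightarrow> real" and m
  proof -
    have f_cont: "continuous_on UNIV f" by (rule linear_continuous_on[OF f])
    have f_lin: "linear f" by (rule bounded_linear.linear[OF f])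
    have clo: "closed {x. f x \<le> m}" "closed {x. f x \<ge> m}"
      by (intro closed_Collect_le f_cont continuous_on_const)+
    have "convex (f -` {..m} \<inter> f -` {m..} \<inter> C)"
      by (intro convex_Int C(3) convex_linear_vimage f_lin) auto
    moreover have "f -` {..m} \<inter> f -` {m..} \<inter> C = (C \<inter> {x. f x \<le> m}) \<inter> (C \<inter> {x. f x \<ge> m})"
      by auto
    ultimately have conn: "connected ((C \<inter> {x. f x \<le> m}) \<inter> (C \<inter> {x. f x \<ge> m}))"
      using convex_connected by metis
    have un: "(C \<inter> {x. f x \<le> m}) \<union> (C \<inter> {x. f x \<ge> m}) = C" by auto
    have "continuous_map (top_of_set C) X g"
      using continuous_map_from_subtopology_mono[OF g C(1)] .
    then show ?thesis
      using pullback_primitive_glue[OF _ _ _ conn] l r C(2) clo un by (metis closed_Int)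
  qed
  have main: "\<exists>F. pullback_primitive X \<A> \<Phi> C g F"
    if "C \<subseteq> T" "closed C" "convex C" "R C (2 ^ n * (e / 3))" for C n
    using that
  proof (induction n arbitrary: C)
    case 0
    \<comment> \<open>The denominator 3 makes the inequality strict: two coordinate differences of
      at most \<open>e / 3\<close> add up to less than \<open>e\<close>.\<close>
    have "dist x y < e" if "x \<in> C" "y \<in> C" for x y
    proof -
      have "dist x y \<le> \<bar>Re (x - y)\<bar> + \<bar>Im (x - y)\<bar>"
        using cmod_le[of "x - y"] by (simp add: dist_norm)
      also have "\<dots> \<le> e / 3 + e / 3" using 0(4) that unfolding R_def by (intro add_mono) auto
      finally show ?thesis using e(1) by simp
    qed
    then show ?case using e(2) 0 by blast
  next
    case (Suc n)
    define d where "d = 2 ^ n * (e / 3)"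
    have R_Suc: "R C (2 * d)" using Suc.prems(4) unfolding d_def by (simp add: mult.assoc)
    have mid: "\<exists>m. \<forall>x\<in>C. \<bar>f x - m\<bar> \<le> d" if f: "\<And>x y. \<lbrakk>x \<in> C; y \<in> C\<rbrakk> \<Longrightarrow> \<bar>f x - f y\<bar> \<le> 2 * d"
      for f :: "complex \<Rightarrow> real"
    proof (cases "C = {}")
      case False
      have bdd: "bdd_above (f ` C)" "bdd_below (f ` C)"
      proof -
        obtain x where x: "x \<in> C" using False by blast
        have "f y \<le> f x + 2 * d" "f x - 2 * d \<le> f y" if "y \<in> C" for y using f[OF x that] by auto
        then show "bdd_above (f ` C)" "bdd_below (f ` C)" by (auto intro!: bdd_aboveI2 bdd_belowI2)
      qed
      have "Sup (f ` C) \<le> Inf (f ` C) + 2 * d"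
      proof (rule cSUP_least[OF False])
        fix x assume x: "x \<in> C"
        have "f x - 2 * d \<le> Inf (f ` C)"
          by (rule cINF_greatest[OF False]) (use f[OF x] in fastforce)
        then show "f x \<le> Inf (f ` C) + 2 * d" by simp
      qed
      moreover have "f x \<le> Sup (f ` C)" "Inf (f ` C) \<le> f x" if "x \<in> C" for x
        using that bdd by (auto intro: cSUP_upper cINF_lower)
      ultimately show ?thesis
        by (intro exI[of _ "Inf (f ` C) + d"]) fastforce
    qed auto
    obtain mR mI where m: "\<forall>x\<in>C. \<bar>Re x - mR\<bar> \<le> d" "\<forall>x\<in>C. \<bar>Im x - mI\<bar> \<le> d"
      using mid[of Re] mid[of Im] R_Suc unfolding R_def by metis
    have clo: "closed {x. Re x \<le> mR}" "closed {x. Re x \<ge> mR}" "closed {x. Im x \<le> mI}" "closed {x. Im x \<ge> mI}"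
      by (intro closed_halfspace_Re_le closed_halfspace_Re_ge closed_halfspace_Im_le closed_halfspace_Im_ge)+
    have cvx: "convex {x. Re x \<le> mR}" "convex {x. Re x \<ge> mR}" "convex {x. Im x \<le> mI}" "convex {x. Im x \<ge> mI}"
      by (intro convex_halfspace_Re_le convex_halfspace_Re_ge convex_halfspace_Im_le convex_halfspace_Im_ge)+
    \<comment> \<open>One number bounds both coordinate extents in \<open>R\<close>, so both cuts
      are made before the induction hypothesis applies; the four quarters are then glued in two
      rounds.\<close>
    have quarter: "\<exists>F. pullback_primitive X \<A> \<Phi> (C \<inter> A \<inter> B) g F"
      if A: "A = {x. Re x \<le> mR} \<or> A = {x. Re x \<ge> mR}" and B: "B = {x. Im x \<le> mI} \<or> B = {x. Im x \<ge> mI}"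
      for A B
    proof (rule Suc.IH)
      have "closed A" "closed B" "convex A" "convex B" using A B clo cvx by blast+
      then show "closed (C \<inter> A \<inter> B)" "convex (C \<inter> A \<inter> B)"
        using Suc.prems(2,3) by (simp_all add: closed_Int convex_Int)
      show "R (C \<inter> A \<inter> B) (2 ^ n * (e / 3))"
        unfolding R_def d_def[symmetric]
      proof (intro ballI)
        fix x y assume xy: "x \<in> C \<inter> A \<inter> B" "y \<in> C \<inter> A \<inter> B"
        then have "Re x \<le> mR \<and> Re y \<le> mR \<or> Re x \<ge> mR \<and> Re y \<ge> mR"
          "Im x \<le> mI \<and> Im y \<le> mI \<or> Im x \<ge> mI \<and> Im y \<ge> mI"
          using A B by blast+
        moreover have "\<bar>Re x - mR\<bar> \<le> d" "\<bar>Re y - mR\<bar> \<le> d" "\<bar>Im x - mI\<bar> \<le> d" "\<bar>Im y - mI\<bar> \<le> d"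
          using m xy by blast+
        ultimately show "\<bar>Re x - Re y\<bar> \<le> d \<and> \<bar>Im x - Im y\<bar> \<le> d" by linarith
      qed
      show "C \<inter> A \<inter> B \<subseteq> T" using Suc.prems(1) by blast
    qed
    have half: "\<exists>F. pullback_primitive X \<A> \<Phi> (C \<inter> A) g F"
      if A: "A = {x. Re x \<le> mR} \<or> A = {x. Re x \<ge> mR}" for A
    proof (rule halves[where f = Im and m = mI])
      have "closed A" "convex A" using A clo cvx by blast+
      then show "closed (C \<inter> A)" "convex (C \<inter> A)"
        using Suc.prems(2,3) by (simp_all add: closed_Int convex_Int)
      show "C \<inter> A \<subseteq> T" using Suc.prems(1) by blast
    qed (rule bounded_linear_Im quarter[OF A] disjI1[OF refl] disjI2[OF refl])+
    show ?case
      by (rule halves[where f = Re and m = mR])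
        (rule Suc.prems bounded_linear_Re half disjI1[OF refl] disjI2[OF refl])+
  qed
  obtain B where B: "B > 0" "\<forall>x\<in>T. norm x \<le> B"
    using compact_imp_bounded[OF \<open>compact T\<close>] bounded_pos by metis
  obtain n where n: "2 * B / (e / 3) < 2 ^ n"
    using real_arch_pow[of 2 "2 * B / (e / 3)"] by auto
  then have n': "2 * B \<le> 2 ^ n * (e / 3)"
    using e(1) by (simp add: divide_less_eq)
  have "R T (2 ^ n * (e / 3))"
    unfolding R_def
  proof (intro ballI conjI)
    fix x y assume "x \<in> T" "y \<in> T"
    then have "norm x \<le> B" "norm y \<le> B" using B by auto
    then show "\<bar>Re x - Re y\<bar> \<le> 2 ^ n * (e / 3)" "\<bar>Im x - Im y\<bar> \<le> 2 ^ n * (e / 3)"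
      using n' abs_Re_le_cmod[of x] abs_Re_le_cmod[of y] abs_Im_le_cmod[of x] abs_Im_le_cmod[of y]
      by linarith+
  qed
  then show ?thesis
    using main[of T n] \<open>compact T\<close> \<open>convex T\<close> compact_imp_closed by blast
qed

text \<open>The definite description is meaningful because two primitives along \<open>c\<close>
  differ by a constant on the connected interval, so they have the same increment.\<close>

lemma path_integral_form_eq:
  assumes c: "continuous_map (top_of_set {0..1}) X c" and F: "pullback_primitive X \<A> \<Phi> {0..1} c F"
  shows "path_integral_form X \<A> \<Phi> c = F 1 - F 0"
  unfolding path_integral_form_def
proof (rule the_equality)
  show "has_path_integral X \<A> \<Phi> c (F 1 - F 0)"
    using F unfolding has_path_integral_iff by blast
  fix I assume "has_path_integral X \<A> \<Phi> c I"
  then obtain G where G: "I = G 1 - G 0" "pullback_primitive X \<A> \<Phi> {0..1} c G"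
    unfolding has_path_integral_iff by blast
  obtain k where "\<And>s. s \<in> {0..1} \<Longrightarrow> F s - G s = k"
    using pullback_primitive_unique[OF c _ F G(2)] unfolding constant_on_def by auto
  from this[of 0] this[of 1] show "I = F 1 - F 0" using G(1) by (simp add: algebra_simps)
qed

text \<open>The interval is identified with the degenerate convex set
  \<open>closed_segment 0 1\<close> in the plane, so that the subdivision argument for plane sets
  covers paths too.\<close>

lemma pullback_primitive_path_exists:
  assumes c: "continuous_map (top_of_set {0..1}) X c"
  shows "\<exists>F. pullback_primitive X \<A> \<Phi> {0..1::real} c F"
proof -
  have "continuous_map (top_of_set (closed_segment 0 1)) (top_of_set {0..1}) Re"
    by (auto simp: closed_segment_eq_real_ivl in_segment continuous_on_Re continuous_on_id)
  then have "continuous_map (top_of_set (closed_segment 0 1)) X (c \<circ> Re)"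
    using c continuous_map_compose by blast
  from pullback_primitive_exists[OF this compact_segment convex_closed_segment]
  obtain F where F: "pullback_primitive X \<A> \<Phi> (closed_segment 0 1) (c \<circ> Re) F" ..
  have "pullback_primitive X \<A> \<Phi> {0..1} c (F \<circ> complex_of_real)"
    by (rule pullback_primitive_compose[OF F])
      (auto simp: in_segment scaleR_conv_of_real intro!: continuous_intros)
  then show ?thesis by blast
qed

end

section \<open>Integrals over singular chains\<close>

text \<open>Cancellation may shrink the support of a difference of chains; summing over a common
  finite set makes the integral visibly additive.\<close>

lemma chain_integral_superset:
  assumes "finite S" "Poly_Mapping.keys \<gamma> \<subseteq> S"
  shows "chain_integral X \<A> \<Phi> \<gamma> =
    (\<Sum>s\<in>S. of_int (Poly_Mapping.lookup \<gamma> s) * path_integral_form X \<A> \<Phi> (simplex_path s))"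
  unfolding chain_integral_def
  by (rule sum.mono_neutral_left) (use assms in \<open>auto simp: in_keys_iff\<close>)

lemma chain_integral_0: "chain_integral X \<A> \<Phi> 0 = 0"
  by (simp add: chain_integral_def)

lemma chain_integral_diff:
  "chain_integral X \<A> \<Phi> (a - b) = chain_integral X \<A> \<Phi> a - chain_integral X \<A> \<Phi> b"
proof -
  let ?S = "Poly_Mapping.keys a \<union> Poly_Mapping.keys b"
  have "chain_integral X \<A> \<Phi> c =
      (\<Sum>s\<in>?S. of_int (Poly_Mapping.lookup c s) * path_integral_form X \<A> \<Phi> (simplex_path s))"
    if "Poly_Mapping.keys c \<subseteq> ?S" for c
    using that by (intro chain_integral_superset) auto
  from this[of a] this[of b] this[of "a - b"] show ?thesis
    using keys_diff[of a b] by (simp add: lookup_minus sum_subtractf algebra_simps)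
qed

lemma chain_integral_add:
  "chain_integral X \<A> \<Phi> (a + b) = chain_integral X \<A> \<Phi> a + chain_integral X \<A> \<Phi> b"
  using chain_integral_diff[of X \<A> \<Phi> a "0 - b"] chain_integral_diff[of X \<A> \<Phi> 0 b]
  by (simp add: chain_integral_0)

lemma chain_integral_frag_of:
  "chain_integral X \<A> \<Phi> (frag_of s) = path_integral_form X \<A> \<Phi> (simplex_path s)"
  by (simp add: chain_integral_def)

lemma continuous_map_simplex_path:
  assumes "singular_simplex 1 X s"
  shows "continuous_map (top_of_set {0..1}) X (simplex_path s)"
proof -
  have "continuous_on {0..1} (\<lambda>t::real. if i = 0 then 1 - t else if i = 1 then t else 0)" for i :: nat
    by (cases "i = 0"; cases "i = 1") (auto intro!: continuous_intros)
  moreover have "(\<lambda>i::nat. if i = 0 then 1 - t else if i = 1 then t else 0) \<in> standard_simplex 1"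
    if "t \<in> {0..1}" for t :: real
    using that by (auto simp: standard_simplex_def)
  ultimately have "continuous_map (top_of_set {0..1::real}) (subtopology (powertop_real UNIV) (standard_simplex 1))
     (\<lambda>t i. if i = 0 then 1 - t else if i = 1 then t else 0)"
    unfolding continuous_map_in_subtopology continuous_map_componentwise_UNIV continuous_map_iff_continuous
    by auto
  from continuous_map_compose[OF this] show ?thesis
    using assms unfolding singular_simplex_def simplex_path_def o_def by blast
qed

text \<open>The triangle with vertices \<open>0, 1, \<i>\<close> in the complex plane serves as the standard 2-simplex.\<close>

definition unit_triangle :: "complex set" where
  "unit_triangle = {z. 0 \<le> Re z} \<inter> {z. 0 \<le> Im z} \<inter> {z. Re z + Im z \<le> 1}"

definition barycentric :: "complex \<Rightarrow> nat \<Rightarrow> real" where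
  "barycentric z = (\<lambda>i. if i = 0 then 1 - Re z - Im z else if i = 1 then Re z else if i = 2 then Im z else 0)"

lemma compact_convex_unit_triangle: "compact unit_triangle" "convex unit_triangle"
proof -
  have lin: "bounded_linear (\<lambda>z. Re z + Im z)"
    by (intro bounded_linear_add bounded_linear_Re bounded_linear_Im)
  have "convex ((\<lambda>z. Re z + Im z) -` {..1})"
    by (intro convex_linear_vimage bounded_linear.linear[OF lin]) auto
  then have "convex {z. Re z + Im z \<le> 1}" by (simp add: vimage_def)
  then show "convex unit_triangle"
    unfolding unit_triangle_def
    by (intro convex_Int convex_halfspace_Re_ge convex_halfspace_Im_ge)
  have "closed unit_triangle"
    unfolding unit_triangle_def
    by (intro closed_Int closed_Collect_le continuous_intros)
  moreover have "norm z \<le> 1" if "z \<in> unit_triangle" for z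
    using cmod_le[of z] that by (simp add: unit_triangle_def)
  then have "bounded unit_triangle" unfolding bounded_iff by blast
  ultimately show "compact unit_triangle" by (simp add: compact_eq_bounded_closed)
qed

lemma continuous_map_barycentric:
  "continuous_map (top_of_set unit_triangle) (subtopology (powertop_real UNIV) (standard_simplex 2)) barycentric"
proof -
  have "continuous_on unit_triangle (\<lambda>z. barycentric z i)" for i
    unfolding barycentric_def
    by (cases "i = 0"; cases "i = 1"; cases "i = 2") (auto intro!: continuous_intros)
  moreover have "barycentric z \<in> standard_simplex 2" if "z \<in> unit_triangle" for z
    using that by (auto simp: standard_simplex_def barycentric_def unit_triangle_def numeral_2_eq_2)
  ultimately show ?thesis
    by (auto simp: continuous_map_in_subtopology continuous_map_componentwise_UNIV)
qed

text \<open>The face opposite to a vertex runs through the other two vertices in increasing order.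
  In the triangle with vertices \<open>0\<close>, \<open>1\<close>, \<open>\<i>\<close> these are
  the edges from \<open>1\<close> to \<open>\<i>\<close>, from \<open>0\<close> to
  \<open>\<i>\<close> and from \<open>0\<close> to \<open>1\<close>.\<close>

lemma simplex_path_singular_face:
  assumes "t \<in> {0..1}"
  shows "simplex_path (singular_face 2 0 s) t = s (barycentric (Complex (1 - t) t))"
    "simplex_path (singular_face 2 1 s) t = s (barycentric (Complex 0 t))"
    "simplex_path (singular_face 2 2 s) t = s (barycentric (Complex t 0))"
proof -
  let ?x = "\<lambda>i::nat. if i = 0 then 1 - t else if i = 1 then t else 0"
  have "?x \<in> standard_simplex 1" using assms by (auto simp: standard_simplex_def)
  then have *: "simplex_path (singular_face 2 k s) t = s (simplical_face k ?x)" for k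
    by (simp add: simplex_path_def singular_face_def)
  have "simplical_face 0 ?x = barycentric (Complex (1 - t) t)"
    "simplical_face 1 ?x = barycentric (Complex 0 t)"
    "simplical_face 2 ?x = barycentric (Complex t 0)"
    by (auto simp: simplical_face_def barycentric_def fun_eq_iff)
  then show "simplex_path (singular_face 2 0 s) t = s (barycentric (Complex (1 - t) t))"
    "simplex_path (singular_face 2 1 s) t = s (barycentric (Complex 0 t))"
    "simplex_path (singular_face 2 2 s) t = s (barycentric (Complex t 0))"
    unfolding * by simp_all
qed

section \<open>Homology invariance of the integrals\<close>

context closed_form
begin

text \<open>One function \<open>F\<close> on the whole triangle computes all three edge integrals,
  and their alternating sum (F(i) - F(1)) - (F(i) - F(0)) + (F(1) - F(0)) cancels.\<close>

lemma chain_integral_boundary_simplex: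
  assumes s: "singular_simplex 2 X s"
  shows "chain_integral X \<A> \<Phi> (chain_boundary 2 (frag_of s)) = 0"
proof -
  have "continuous_map (top_of_set unit_triangle) X (s \<circ> barycentric)"
    using continuous_map_compose[OF continuous_map_barycentric] s unfolding singular_simplex_def by blast
  from pullback_primitive_exists[OF this compact_convex_unit_triangle]
  obtain F where F: "pullback_primitive X \<A> \<Phi> unit_triangle (s \<circ> barycentric) F" by blast
  have face: "path_integral_form X \<A> \<Phi> (simplex_path (singular_face 2 k s)) = F (e 1) - F (e 0)"
    if k: "k \<le> 2" and e: "continuous_on {0..1} e" "e ` {0..1} \<subseteq> unit_triangle"
      and eq: "\<And>t. t \<in> {0..1} \<Longrightarrow> simplex_path (singular_face 2 k s) t = s (barycentric (e t))" for k e
  proof -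
    have "singular_simplex 1 X (singular_face 2 k s)"
      using singular_simplex_singular_face[OF s, of k] k by simp
    from path_integral_form_eq[OF continuous_map_simplex_path[OF this]
        pullback_primitive_compose[OF F e, of "simplex_path (singular_face 2 k s)"]]
    show ?thesis using eq by simp
  qed
  have cont: "continuous_on {0..1} (\<lambda>t. Complex (a t) (b t))"
    if "continuous_on {0..1} a" "continuous_on {0..1} b" for a b :: "real \<Rightarrow> real"
    unfolding Complex_eq using that by (intro continuous_intros)
  have corners: "Complex 0 0 = 0" "Complex 1 0 = 1" "Complex 0 1 = \<i>"
    by (simp_all add: complex_eq_iff)
  have "path_integral_form X \<A> \<Phi> (simplex_path (singular_face 2 0 s)) =
      F (Complex (1 - 1) 1) - F (Complex (1 - 0) 0)"
    by (rule face[of 0 "\<lambda>t. Complex (1 - t) t"])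
      (auto simp: unit_triangle_def simplex_path_singular_face(1) intro!: cont continuous_intros)
  moreover have "path_integral_form X \<A> \<Phi> (simplex_path (singular_face 2 1 s)) =
      F (Complex 0 1) - F (Complex 0 0)"
    by (rule face[of 1 "\<lambda>t. Complex 0 t"])
      (auto simp: unit_triangle_def simplex_path_singular_face(2)[unfolded One_nat_def] intro!: cont continuous_intros)
  moreover have "path_integral_form X \<A> \<Phi> (simplex_path (singular_face 2 2 s)) =
      F (Complex 1 0) - F (Complex 0 0)"
    by (rule face[of 2 "\<lambda>t. Complex t 0"])
      (auto simp: unit_triangle_def simplex_path_singular_face(3) intro!: cont continuous_intros)
  moreover have "chain_boundary 2 (frag_of s) =
      frag_of (singular_face 2 0 s) - frag_of (singular_face 2 1 s) + frag_of (singular_face 2 2 s)"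
    by (simp add: chain_boundary_of numeral_2_eq_2)
  ultimately show ?thesis
    by (simp add: chain_integral_add chain_integral_diff chain_integral_frag_of corners)
qed

lemma chain_integral_boundary:
  assumes "singular_chain 2 X d"
  shows "chain_integral X \<A> \<Phi> (chain_boundary 2 d) = 0"
  using assms unfolding singular_chain_def
  by (induction d rule: frag_induction)
    (simp_all add: chain_integral_0 chain_integral_boundary_simplex chain_boundary_diff chain_integral_diff)

lemma chain_integral_homologous:
  assumes "homologous_rel 1 X {} a b"
  shows "chain_integral X \<A> \<Phi> a = chain_integral X \<A> \<Phi> b"
proof -
  obtain d where "singular_chain 2 X d" "chain_boundary 2 d = a - b"
    using assms unfolding homologous_rel_def singular_relboundary_def mod_subset_empty
    by (metis Suc_1)
  then show ?thesis using chain_integral_boundary[of d] by (simp add: chain_integral_diff)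
qed

text \<open>The common value exists and is unique because the class contains \<gamma> and its
  members differ from \<gamma> by boundaries.\<close>

lemma class_integral_homology_class:
  "class_integral X \<A> \<Phi> (homologous_rel_set 1 X {} \<gamma>) = chain_integral X \<A> \<Phi> \<gamma>"
  unfolding class_integral_def
  by (rule the_equality) (use chain_integral_homologous in auto)

end

text \<open>The hypothesis \<open>pull\<close> is the integrated form of the statement that the
  pullback of \<Phi> by \<sigma> is k times \<Psi>: each primitive of \<Psi> is carried forward to
  one of \<Phi>. Increments along the image of a path are then k times those along the path.\<close>

lemma chain_integral_chain_map:
  assumes \<Phi>: "closed_form X \<A> \<Phi>" and \<Psi>: "closed_form X \<A> \<Psi>" and \<sigma>: "continuous_map X X \<sigma>"
    and pull: "\<And>U h. local_primitive X \<A> \<Psi> U h \<Longrightarrow>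
      \<exists>U' h'. local_primitive X \<A> \<Phi> U' h' \<and> (\<forall>p\<in>U. \<sigma> p \<in> U' \<and> h' (\<sigma> p) = k * h p)"
    and \<gamma>: "singular_chain 1 X \<gamma>"
  shows "chain_integral X \<A> \<Phi> (chain_map 1 \<sigma> \<gamma>) = k * chain_integral X \<A> \<Psi> \<gamma>"
  using \<gamma> unfolding singular_chain_def
proof (induction \<gamma> rule: frag_induction)
  case (one s)
  then have s: "singular_simplex 1 X s" by simp
  obtain F where F: "pullback_primitive X \<A> \<Psi> {0..1} (simplex_path s) F"
    using closed_form.pullback_primitive_path_exists[OF \<Psi> continuous_map_simplex_path[OF s]] by blast
  \<comment> \<open>The simplex \<open>simplex_map 1 \<sigma> s\<close> is a restriction to the
    standard simplex, whence the condition on \<open>t\<close>.\<close>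
  have path: "simplex_path (simplex_map 1 \<sigma> s) t = \<sigma> (simplex_path s t)" if "t \<in> {0..1}" for t
  proof -
    have "(\<lambda>i::nat. if i = 0 then 1 - t else if i = 1 then t else 0) \<in> standard_simplex 1"
      using that by (auto simp: standard_simplex_def)
    then show ?thesis by (simp add: simplex_path_def simplex_map_def)
  qed
  have "pullback_primitive X \<A> \<Phi> {0..1} (simplex_path (simplex_map 1 \<sigma> s)) (\<lambda>t. k * F t)"
    unfolding pullback_primitive_def
  proof
    fix t :: real assume "t \<in> {0..1}"
    then obtain U h where U: "local_primitive X \<A> \<Psi> U h"
        "\<forall>\<^sub>F x in nhds t. x \<in> {0..1} \<longrightarrow> simplex_path s x \<in> U \<and> F x = h (simplex_path s x)"
      using F unfolding pullback_primitive_def by blast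
    obtain U' h' where U': "local_primitive X \<A> \<Phi> U' h'" "\<forall>p\<in>U. \<sigma> p \<in> U' \<and> h' (\<sigma> p) = k * h p"
      using pull[OF U(1)] by blast
    have "\<forall>\<^sub>F x in nhds t. x \<in> {0..1} \<longrightarrow> simplex_path (simplex_map 1 \<sigma> s) x \<in> U' \<and>
        k * F x = h' (simplex_path (simplex_map 1 \<sigma> s) x)"
      using U(2) by (rule eventually_mono) (metis U'(2) path)
    then show "\<exists>U h. local_primitive X \<A> \<Phi> U h \<and> (\<forall>\<^sub>F x in nhds t. x \<in> {0..1} \<longrightarrow>
        simplex_path (simplex_map 1 \<sigma> s) x \<in> U \<and> k * F x = h (simplex_path (simplex_map 1 \<sigma> s) x))"
      using U'(1) by blast
  qed
  from closed_form.path_integral_form_eq[OF \<Phi> continuous_map_simplex_path[OF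
        singular_simplex_simplex_map[OF s \<sigma>]] this]
    closed_form.path_integral_form_eq[OF \<Psi> continuous_map_simplex_path[OF s] F]
  show ?case by (simp add: chain_integral_frag_of right_diff_distrib)
next
  case (diff a b)
  then show ?case by (simp add: chain_map_diff chain_integral_diff algebra_simps)
qed (simp add: chain_integral_0)

section \<open>Local coordinates on the curve\<close>

definition curve_poly :: "complex \<Rightarrow> complex" where
  "curve_poly w = w ^ 8 - 14 * w ^ 4 + 1"

definition curve_poly' :: "complex \<Rightarrow> complex" where
  "curve_poly' w = 8 * w ^ 7 - 56 * w ^ 3"

lemma mem_affine_curve: "(w, y) \<in> affine_curve \<longleftrightarrow> y\<^sup>2 = curve_poly w"
  by (simp add: affine_curve_def curve_poly_def)

lemma curve_poly_deriv: "(curve_poly has_field_derivative curve_poly' w) (at w)"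
  unfolding curve_poly_def[abs_def] curve_poly'_def by (auto intro!: derivative_eq_intros)

lemma holomorphic_curve_poly: "curve_poly holomorphic_on S" "curve_poly' holomorphic_on S"
  unfolding curve_poly_def[abs_def] curve_poly'_def[abs_def] by (intro holomorphic_intros)+

lemma curve_poly_palindromic: "u \<noteq> 0 \<Longrightarrow> curve_poly (1 / u) = curve_poly u / u ^ 8"
  by (simp add: curve_poly_def field_simps power_divide flip: power_add)

text \<open>The derivative is 8 w^3 (w^4 - 7), and the polynomial takes the value 1 at w = 0 and 49
  - 98 + 1 = -48 where w^4 = 7.\<close>

lemma curve_poly_simple_roots:
  assumes "curve_poly w = 0"
  shows "curve_poly' w \<noteq> 0"
proof
  assume "curve_poly' w = 0"
  then have "8 * w ^ 3 * (w ^ 4 - 7) = 0"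
    by (simp add: curve_poly'_def algebra_simps flip: power_add)
  then have "w = 0 \<or> w ^ 4 = 7" by simp
  moreover have "w ^ 8 = w ^ 4 * w ^ 4" by (simp flip: power_add)
  ultimately show False using assms unfolding curve_poly_def by (elim disjE) simp_all
qed

text \<open>Dividing by \<open>y0\<^sup>2\<close> normalises the radicand to 1 at \<open>w0\<close>.
  On a small disc it stays in the right half plane, where the principal root is holomorphic, and the
  factor \<open>y0\<close> restores the prescribed value. The derivative comes from differentiating
  the square.\<close>

lemma curve_poly_sqrt_branch:
  assumes y: "y0\<^sup>2 = curve_poly w0" "y0 \<noteq> 0"
  obtains r s where "r > 0" "s holomorphic_on ball w0 r" "s w0 = y0"
    "\<And>w. w \<in> ball w0 r \<Longrightarrow> (s w)\<^sup>2 = curve_poly w" "\<And>w. w \<in> ball w0 r \<Longrightarrow> s w \<noteq> 0"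
    "\<And>w. w \<in> ball w0 r \<Longrightarrow> (s has_field_derivative curve_poly' w / (2 * s w)) (at w)"
proof -
  define f where "f w = curve_poly w / y0\<^sup>2" for w
  have hol: "f holomorphic_on S" for S
    unfolding f_def by (intro holomorphic_intros holomorphic_curve_poly) (use y(2) in simp)
  have f0: "f w0 = 1" using y(2) by (simp add: f_def flip: y(1))
  have "isCont f w0"
    using holomorphic_on_imp_continuous_on[OF hol[of UNIV]] by (simp add: continuous_on_eq_continuous_at)
  then obtain r where r: "r > 0" "\<And>w. w \<in> ball w0 r \<Longrightarrow> dist (f w) 1 < 1"
    unfolding continuous_at_eps_delta using f0 by (metis dist_commute mem_ball zero_less_one)
  have pos: "Re (f w) > 0" if "w \<in> ball w0 r" for w
    using r(2)[OF that] abs_Re_le_cmod[of "f w - 1"] by (simp add: dist_norm)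
  define s where "s w = y0 * csqrt (f w)" for w
  have s_hol: "s holomorphic_on ball w0 r"
    unfolding s_def by (intro holomorphic_intros hol) (use pos in \<open>force simp: complex_nonpos_Reals_iff\<close>)
  have s_sq: "(s w)\<^sup>2 = curve_poly w" for w
    using y(2) by (simp add: s_def power_mult_distrib f_def)
  have s_nz: "s w \<noteq> 0" if "w \<in> ball w0 r" for w
    using pos[OF that] y(2) by (auto simp: s_def)
  have "(s has_field_derivative curve_poly' w / (2 * s w)) (at w)" if w: "w \<in> ball w0 r" for w
  proof -
    have ds: "(s has_field_derivative deriv s w) (at w)"
      using holomorphic_derivI[OF s_hol open_ball w] .
    have "((\<lambda>w. (s w)\<^sup>2) has_field_derivative 2 * s w * deriv s w) (at w)"
      using DERIV_power[OF ds, of 2] by (simp add: ac_simps)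
    then have "2 * s w * deriv s w = curve_poly' w"
      unfolding s_sq using curve_poly_deriv DERIV_unique by blast
    then have "deriv s w = curve_poly' w / (2 * s w)" using s_nz[OF w] by (simp add: field_simps)
    then show ?thesis using ds by simp
  qed
  moreover have "s w0 = y0" by (simp add: s_def f0)
  ultimately show thesis using that r(1) s_hol s_sq s_nz by blast
qed

text \<open>The branch is \<rho>(y) = g(y^2) for a local inverse g of the polynomial near
  \<open>w0\<close>. The set \<open>N\<close>, on which the polynomial is injective, is returned as
  well: it is what later separates the graph of \<rho> from other points of the curve with the same
  y.\<close>

lemma curve_poly_inverse_branch:
  assumes y: "y0\<^sup>2 = curve_poly w0" "curve_poly' w0 \<noteq> 0"
  obtains r \<rho> N where "r > 0" "\<rho> holomorphic_on ball y0 r" "\<rho> y0 = w0"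
    "\<And>y. y \<in> ball y0 r \<Longrightarrow> y\<^sup>2 = curve_poly (\<rho> y)" "\<And>y. y \<in> ball y0 r \<Longrightarrow> curve_poly' (\<rho> y) \<noteq> 0"
    "\<And>y. y \<in> ball y0 r \<Longrightarrow> (\<rho> has_field_derivative 2 * y / curve_poly' (\<rho> y)) (at y)"
    "open N" "inj_on curve_poly N" "\<And>y. y \<in> ball y0 r \<Longrightarrow> \<rho> y \<in> N"
proof -
  define S where "S = {w. curve_poly' w \<noteq> 0}"
  have "continuous_on UNIV curve_poly'"
    using holomorphic_on_imp_continuous_on holomorphic_curve_poly by blast
  then have "open S" unfolding S_def by (intro open_Collect_neq continuous_on_const)
  moreover have "deriv curve_poly w0 \<noteq> 0" using y DERIV_imp_deriv[OF curve_poly_deriv] by simp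
  ultimately obtain R where R: "R > 0" "ball w0 R \<subseteq> S" "open (curve_poly ` ball w0 R)" "inj_on curve_poly (ball w0 R)"
    using has_complex_derivative_locally_invertible[OF holomorphic_curve_poly(1)[of S], of w0] y
    unfolding S_def by blast
  obtain g where g: "g holomorphic_on (curve_poly ` ball w0 R)"
      "\<And>z. z \<in> ball w0 R \<Longrightarrow> g (curve_poly z) = z"
    using holomorphic_has_inverse[OF holomorphic_curve_poly(1) open_ball R(4)] by metis
  have "y0\<^sup>2 \<in> curve_poly ` ball w0 R" using y R(1) by auto
  moreover have "open ((\<lambda>y. y\<^sup>2) -` (curve_poly ` ball w0 R))"
    by (intro open_vimage R(3) continuous_intros)
  ultimately obtain r where r: "r > 0" "ball y0 r \<subseteq> (\<lambda>y. y\<^sup>2) -` (curve_poly ` ball w0 R)"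
    by (metis open_contains_ball vimageI2)
  define \<rho> where "\<rho> y = g (y\<^sup>2)" for y
  have mem: "\<rho> y \<in> ball w0 R \<and> y\<^sup>2 = curve_poly (\<rho> y)" if "y \<in> ball y0 r" for y
  proof -
    obtain w where "w \<in> ball w0 R" "y\<^sup>2 = curve_poly w" using r(2) \<open>y \<in> ball y0 r\<close> by auto
    then show ?thesis unfolding \<rho>_def using g(2) by auto
  qed
  have hol: "\<rho> holomorphic_on ball y0 r"
    unfolding \<rho>_def
    by (rule holomorphic_on_compose_gen[of "\<lambda>y. y\<^sup>2" _ g, unfolded o_def, OF _ g(1)])
      (use r(2) in \<open>auto intro!: holomorphic_intros\<close>)
  have nz: "curve_poly' (\<rho> y) \<noteq> 0" if "y \<in> ball y0 r" for y
    using mem[OF that] R(2) by (auto simp: S_def)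
  have der: "(\<rho> has_field_derivative 2 * y / curve_poly' (\<rho> y)) (at y)" if y: "y \<in> ball y0 r" for y
  proof -
    have d: "(\<rho> has_field_derivative deriv \<rho> y) (at y)"
      using holomorphic_derivI[OF hol open_ball y] .
    have "((\<lambda>y. curve_poly (\<rho> y)) has_field_derivative curve_poly' (\<rho> y) * deriv \<rho> y) (at y)"
      by (rule DERIV_chain2[OF curve_poly_deriv d])
    then have "((\<lambda>y. y\<^sup>2) has_field_derivative curve_poly' (\<rho> y) * deriv \<rho> y) (at y)"
      by (rule has_field_derivative_transform_within_open[OF _ open_ball y]) (use mem in auto)
    moreover have "((\<lambda>y. y\<^sup>2) has_field_derivative 2 * y) (at y)"
      by (auto intro!: derivative_eq_intros)
    ultimately have "curve_poly' (\<rho> y) * deriv \<rho> y = 2 * y" by (rule DERIV_unique)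
    then have "deriv \<rho> y = 2 * y / curve_poly' (\<rho> y)" using nz[OF y] by (simp add: field_simps)
    then show ?thesis using d by simp
  qed
  have "\<rho> y0 = w0" using g(2)[of w0] R(1) y by (simp add: \<rho>_def)
  then show thesis
    using that[OF r(1) hol, where N = "ball w0 R"] mem nz der R(4) by blast
qed

text \<open>At \<open>x\<close> the sum f + g equals 2 f(x), which is nonzero; so near
  \<open>x\<close> the alternative f = -g is impossible.\<close>

lemma square_roots_eventually_eq:
  fixes f g :: "complex \<Rightarrow> complex"
  assumes "isCont f x" "isCont g x" "f x = g x" "f x \<noteq> 0" "\<forall>\<^sub>F t in nhds x. (f t)\<^sup>2 = (g t)\<^sup>2"
  shows "\<forall>\<^sub>F t in nhds x. f t = g t"
proof -
  have "isCont (\<lambda>t. f t + g t) x" using assms by (intro continuous_intros)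
  then have "((\<lambda>t. f t + g t) \<longlongrightarrow> f x + g x) (nhds x)"
    by (simp add: continuous_at tendsto_at_iff_tendsto_nhds[of "\<lambda>t. f t + g t"])
  moreover have "f x + g x \<noteq> 0" using assms(3,4) by simp
  ultimately have "\<forall>\<^sub>F t in nhds x. f t + g t \<noteq> 0"
    by (rule tendsto_imp_eventually_ne)
  with assms(5) show ?thesis
    by eventually_elim (auto simp: power2_eq_iff)
qed

section \<open>The topology glued from two affine patches\<close>

definition transition :: "complex \<times> complex \<Rightarrow> complex \<times> complex" where
  "transition q = (1 / fst q, snd q / fst q ^ 4)"

lemma transition_affine_curve:
  assumes "q \<in> affine_curve" "fst q \<noteq> 0"
  shows "transition q \<in> affine_curve"
proof -
  obtain u v where q: "q = (u, v)" by fastforce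
  have "v\<^sup>2 = curve_poly u" "u \<noteq> 0" using assms by (simp_all add: q mem_affine_curve)
  then show ?thesis
    by (simp add: q transition_def mem_affine_curve curve_poly_palindromic power_divide flip: power_mult)
qed

lemma patch_transition:
  assumes "fst q \<noteq> 0"
  shows "patch_zero (transition q) = patch_inf q"
  using assms by (cases q) (simp add: transition_def)

lemma openin_transition_preimage:
  assumes "openin (top_of_set affine_curve) W"
  shows "openin (top_of_set affine_curve) {q \<in> affine_curve. fst q \<noteq> 0 \<and> transition q \<in> W}"
proof -
  let ?D = "affine_curve \<inter> {q. fst q \<noteq> 0}"
  have D: "openin (top_of_set affine_curve) ?D"
    by (intro openin_open_Int open_Collect_neq continuous_intros)
  have "continuous_on ?D transition"
    unfolding transition_def by (intro continuous_intros) auto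
  moreover have "transition ` ?D \<subseteq> affine_curve" using transition_affine_curve by auto
  ultimately have "openin (top_of_set ?D) (?D \<inter> transition -` W)"
    using assms by (intro continuous_openin_preimage) auto
  then have "openin (top_of_set affine_curve) (?D \<inter> transition -` W)"
    using D openin_trans by blast
  moreover have "?D \<inter> transition -` W = {q \<in> affine_curve. fst q \<noteq> 0 \<and> transition q \<in> W}" by auto
  ultimately show ?thesis by simp
qed

lemma patch_zero_eq_iff: "patch_zero p = patch_zero q \<longleftrightarrow> p = q"
  by (cases p; cases q) auto

lemma patch_inf_eq_iff: "patch_inf p = patch_inf q \<longleftrightarrow> p = q"
  by (cases p; cases q) auto

lemma patch_zero_eq_patch_inf_iff: "patch_zero p = patch_inf q \<longleftrightarrow> fst q \<noteq> 0 \<and> p = transition q"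
  by (cases p; cases q) (auto simp: transition_def)

text \<open>The same formula serves for both directions of the gluing because
  \<open>transition\<close> is an involution where the first coordinate is nonzero.\<close>

lemma patch_inf_eq_patch_zero_iff: "patch_inf p = patch_zero q \<longleftrightarrow> fst q \<noteq> 0 \<and> p = transition q"
  by (cases p; cases q) (auto simp: transition_def power_divide)

declare patch_zero.simps [simp del] patch_inf.simps [simp del]

text \<open>Openness must be checked in both patches: in its own patch the image is \<open>W\<close>
  again, in the other one it is the preimage of \<open>W\<close> under the continuous change of
  patch.\<close>

lemma openin_patch_zero_image:
  assumes "openin (top_of_set affine_curve) W"
  shows "openin Sigma_surf (patch_zero ` W)"
proof -
  have sub: "W \<subseteq> affine_curve" using assms openin_imp_subset by blast
  have "{q \<in> affine_curve. patch_zero q \<in> patch_zero ` W} = W"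
    using sub by (auto simp: patch_zero_eq_iff)
  moreover have "patch_inf q \<in> patch_zero ` W \<longleftrightarrow> fst q \<noteq> 0 \<and> transition q \<in> W" for q
    unfolding image_iff by (metis patch_zero_eq_patch_inf_iff)
  ultimately show ?thesis
    unfolding openin_Sigma_surf Sigma_open_def using assms sub openin_transition_preimage by auto
qed

lemma openin_patch_inf_image:
  assumes "openin (top_of_set affine_curve) W"
  shows "openin Sigma_surf (patch_inf ` W)"
proof -
  have sub: "W \<subseteq> affine_curve" using assms openin_imp_subset by blast
  have "{q \<in> affine_curve. patch_inf q \<in> patch_inf ` W} = W"
    using sub by (auto simp: patch_inf_eq_iff)
  moreover have "patch_zero q \<in> patch_inf ` W \<longleftrightarrow> fst q \<noteq> 0 \<and> transition q \<in> W" for q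
    unfolding image_iff by (metis patch_inf_eq_patch_zero_iff)
  ultimately show ?thesis
    unfolding openin_Sigma_surf Sigma_open_def using assms sub openin_transition_preimage by auto
qed

text \<open>Turns openness in the glued surface into a statement about a local parametrisation: a
  continuous arc on the affine curve, seen through either patch, stays in an open set near its
  parameter.\<close>

lemma eventually_patch_mem:
  assumes V: "openin Sigma_surf V" and \<pi>: "\<pi> = patch_zero \<or> \<pi> = patch_inf"
    and f: "isCont f x" and aff: "\<forall>\<^sub>F t in nhds x. f t \<in> affine_curve" and mem: "\<pi> (f x) \<in> V"
  shows "\<forall>\<^sub>F t in nhds (x :: complex). \<pi> (f t) \<in> V"
proof -
  have "openin (top_of_set affine_curve) {q \<in> affine_curve. \<pi> q \<in> V}"
    using V \<pi> unfolding openin_Sigma_surf Sigma_open_def by auto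
  then obtain S where S: "open S" "{q \<in> affine_curve. \<pi> q \<in> V} = affine_curve \<inter> S"
    unfolding openin_open by blast
  have "f x \<in> affine_curve" using aff by (rule eventually_nhds_x_imp_x)
  then have "f x \<in> S" using S(2) mem by blast
  have "filterlim f (nhds (f x)) (nhds x)" using f by (simp add: continuous_at tendsto_at_iff_tendsto_nhds)
  moreover have "\<forall>\<^sub>F q in nhds (f x). q \<in> S"
    using S(1) \<open>f x \<in> S\<close> by (rule eventually_nhds_in_open)
  ultimately have "\<forall>\<^sub>F t in nhds x. f t \<in> S" unfolding filterlim_iff by blast
  with aff show ?thesis by eventually_elim (use S(2) in blast)
qed

lemma mem_topspace_Sigma_surf:
  "Aff w y \<in> topspace Sigma_surf \<longleftrightarrow> (w, y) \<in> affine_curve"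
  "Infty v \<in> topspace Sigma_surf \<longleftrightarrow> v\<^sup>2 = 1"
proof -
  have "patch_inf q \<in> patch_zero ` affine_curve" if "q \<in> affine_curve" "fst q \<noteq> 0" for q
    using patch_transition[OF that(2)] transition_affine_curve[OF that] by (metis image_eqI)
  then have "Aff w y \<in> patch_inf ` affine_curve \<Longrightarrow> Aff w y \<in> patch_zero ` affine_curve"
    by (force simp: patch_inf.simps split: if_splits)
  moreover have "Aff w y \<in> patch_zero ` affine_curve \<longleftrightarrow> (w, y) \<in> affine_curve"
    by (force simp: patch_zero.simps)
  ultimately show "Aff w y \<in> topspace Sigma_surf \<longleftrightarrow> (w, y) \<in> affine_curve"
    unfolding topspace_Sigma_surf by blast
  have "Infty v \<in> topspace Sigma_surf \<longleftrightarrow> (0, v) \<in> affine_curve"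
    unfolding topspace_Sigma_surf by (force simp: patch_zero.simps patch_inf.simps split: if_splits)
  then show "Infty v \<in> topspace Sigma_surf \<longleftrightarrow> v\<^sup>2 = 1"
    by (simp add: affine_curve_def)
qed

text \<open>The values at \<open>Aff 2 3\<close> are 2, 3 and 1/2. The functions live on the whole
  datatype, so the test point may lie off the curve.\<close>

lemma chart_functions_distinct [simp]:
  "omega_fun \<noteq> y_fun" "omega_fun \<noteq> u_fun" "y_fun \<noteq> u_fun"
  "y_fun \<noteq> omega_fun" "u_fun \<noteq> omega_fun" "u_fun \<noteq> y_fun"
  by (auto dest: fun_cong[of _ _ "Aff 2 3"])

lemma Sigma_atlas_cases:
  assumes "(V, z) \<in> Sigma_atlas"
  obtains (omega) "z = omega_fun" "V \<subseteq> {Aff w y | w y. y \<noteq> 0}"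
    | (y) "z = y_fun" "V \<subseteq> {Aff w y | w y. curve_poly' w \<noteq> 0}"
    | (u) "z = u_fun" "V \<subseteq> {Aff w y | w y. w \<noteq> 0 \<and> y \<noteq> 0} \<union> range Infty"
  using assms unfolding Sigma_atlas_def curve_poly'_def by auto

lemma Sigma_atlasD:
  assumes "(V, z) \<in> Sigma_atlas"
  shows "openin Sigma_surf V" "inj_on z V"
  using assms unfolding Sigma_atlas_def by auto

lemma Aff_in_chart:
  assumes "(V, z) \<in> Sigma_atlas" "Aff w y \<in> V"
  shows "y\<^sup>2 = curve_poly w"
proof -
  have "Aff w y \<in> topspace Sigma_surf"
    using Sigma_atlasD(1)[OF assms(1)] assms(2) openin_subset by blast
  then show ?thesis by (simp add: mem_topspace_Sigma_surf mem_affine_curve)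
qed

lemma omega_y_u_patch:
  "omega_fun (patch_zero (w, y)) = w" "y_fun (patch_zero (w, y)) = y" "u_fun (patch_inf (w, y)) = w"
  by (simp_all add: patch_zero.simps patch_inf.simps)

text \<open>A continuous section of the coordinate through a point of \<open>V\<close> remains in
  the open set \<open>V\<close>, and injectivity of the coordinate on \<open>V\<close> forces it to
  be the inverse chart there. Thus \<open>inv_into\<close> can be replaced by an explicit
  branch.\<close>

lemma inv_into_chart_eventually:
  fixes \<tau> :: "complex \<Rightarrow> complex \<times> complex"
  assumes V: "(V, z) \<in> Sigma_atlas" and \<pi>: "\<pi> = patch_zero \<or> \<pi> = patch_inf"
    and \<tau>: "isCont \<tau> x" "\<forall>\<^sub>F t in nhds x. \<tau> t \<in> affine_curve" "\<pi> (\<tau> x) \<in> V"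
    and z: "\<And>t. z (\<pi> (\<tau> t)) = t"
  shows "\<forall>\<^sub>F t in nhds x. inv_into V z t = \<pi> (\<tau> t)"
proof -
  have "\<forall>\<^sub>F t in nhds x. \<pi> (\<tau> t) \<in> V"
    by (rule eventually_patch_mem[OF Sigma_atlasD(1)[OF V] \<pi> \<tau>])
  then show ?thesis
    by eventually_elim (use Sigma_atlasD(2)[OF V] z in \<open>simp add: inv_into_f_eq\<close>)
qed

lemma inv_into_omega_chart:
  assumes V: "(V, omega_fun) \<in> Sigma_atlas" "Aff w y \<in> V"
    and s: "isCont s w" "s w = y" "\<forall>\<^sub>F t in nhds w. (s t)\<^sup>2 = curve_poly t"
  shows "\<forall>\<^sub>F t in nhds w. inv_into V omega_fun t = Aff t (s t)"
  using inv_into_chart_eventually[OF V(1), where \<pi> = patch_zero and \<tau> = "\<lambda>t. (t, s t)" and x = w] assms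
  by (simp add: mem_affine_curve patch_zero.simps)

lemma inv_into_y_chart:
  assumes V: "(V, y_fun) \<in> Sigma_atlas" "Aff w y \<in> V"
    and r: "isCont \<rho> y" "\<rho> y = w" "\<forall>\<^sub>F t in nhds y. t\<^sup>2 = curve_poly (\<rho> t)"
  shows "\<forall>\<^sub>F t in nhds y. inv_into V y_fun t = Aff (\<rho> t) t"
  using inv_into_chart_eventually[OF V(1), where \<pi> = patch_zero and \<tau> = "\<lambda>t. (\<rho> t, t)" and x = y] assms
  by (simp add: mem_affine_curve patch_zero.simps)

lemma inv_into_u_chart:
  assumes V: "(V, u_fun) \<in> Sigma_atlas" "patch_inf (u, v) \<in> V"
    and s: "isCont s u" "s u = v" "\<forall>\<^sub>F t in nhds u. (s t)\<^sup>2 = curve_poly t"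
  shows "\<forall>\<^sub>F t in nhds u. inv_into V u_fun t = patch_inf (t, s t)"
  using inv_into_chart_eventually[OF V(1), where \<pi> = patch_inf and \<tau> = "\<lambda>t. (t, s t)" and x = u] assms
  by (simp add: mem_affine_curve omega_y_u_patch)

section \<open>Coefficients of the forms in the three kinds of charts\<close>

definition quadratic_form :: "complex \<Rightarrow> complex \<Rightarrow> complex \<Rightarrow> curve_point one_form" where
  "quadratic_form a b c =
     form_times_d (\<lambda>p. (a + b * omega_fun p + c * (omega_fun p)\<^sup>2) / y_fun p) omega_fun"

text \<open>The coefficient is a limit over a punctured neighbourhood, so \<open>D\<close> and
  \<open>eq\<close> are required only away from the centre. The function \<phi> is the continuous
  extension, which makes the rule applicable at branch points and at infinity, where the raw
  quotient has no useful value.\<close>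

lemma quadratic_form_eqI:
  assumes inv: "\<forall>\<^sub>F t in nhds (z p). inv_into V z t = \<tau> t"
    and D: "\<forall>\<^sub>F t in at (z p). ((\<lambda>t. omega_fun (\<tau> t)) has_field_derivative D t) (at t)"
    and eq: "\<forall>\<^sub>F t in at (z p). (a + b * omega_fun (\<tau> t) + c * (omega_fun (\<tau> t))\<^sup>2) / y_fun (\<tau> t) * D t = \<phi> t"
    and lim: "isCont \<phi> (z p)" and L: "\<phi> (z p) = L"
  shows "quadratic_form a b c (V, z) p = L"
proof -
  \<comment> \<open>Replacing the inverse chart inside \<open>deriv\<close> needs agreement on a
    whole neighbourhood of each nearby \<open>t\<close>, not just at \<open>t\<close>.\<close>
  have inv2: "\<forall>\<^sub>F t in at (z p). \<forall>\<^sub>F t' in nhds t. inv_into V z t' = \<tau> t'"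
    using iffD2[OF eventually_eventually inv] eventually_nhds_conv_at by blast
  have "\<forall>\<^sub>F t in at (z p). \<phi> t = (a + b * omega_fun (inv_into V z t) + c * (omega_fun (inv_into V z t))\<^sup>2)
      / y_fun (inv_into V z t) * deriv (omega_fun \<circ> inv_into V z) t"
    using inv2 D eq
  proof eventually_elim
    case (elim t)
    have "deriv (omega_fun \<circ> inv_into V z) t = deriv (\<lambda>t. omega_fun (\<tau> t)) t"
      by (rule deriv_cong_ev) (use elim(1) in \<open>auto elim: eventually_mono\<close>)
    also have "\<dots> = D t" using elim(2) by (rule DERIV_imp_deriv)
    finally show ?case using elim(3) eventually_nhds_x_imp_x[OF elim(1)] by simp
  qed
  then have "((\<lambda>t. (a + b * omega_fun (inv_into V z t) + c * (omega_fun (inv_into V z t))\<^sup>2)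
      / y_fun (inv_into V z t) * deriv (omega_fun \<circ> inv_into V z) t) \<longlongrightarrow> L) (at (z p))"
    by (rule tendsto_cong[THEN iffD1]) (use lim L in \<open>simp add: continuous_at\<close>)
  from tendsto_Lim[OF trivial_limit_at this] show ?thesis
    unfolding quadratic_form_def form_times_d_def by simp
qed

lemma eventually_nhds_ball:
  assumes "r > 0" "\<And>t. t \<in> ball x r \<Longrightarrow> Q t"
  shows "\<forall>\<^sub>F t in nhds x. Q t"
  using eventually_nhds_in_open[of "ball x r" x] assms by (auto elim: eventually_mono)

lemma holomorphic_on_ball_isCont:
  assumes "f holomorphic_on ball x r" "r > 0"
  shows "isCont f x"
  using continuous_on_interior[OF holomorphic_on_imp_continuous_on[OF assms(1)]] assms(2) by simp

lemma quadratic_form_omega_chart: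
  assumes V: "(V, omega_fun) \<in> Sigma_atlas" "Aff w y \<in> V"
  shows "quadratic_form a b c (V, omega_fun) (Aff w y) = (a + b * w + c * w\<^sup>2) / y"
proof -
  have y: "y \<noteq> 0"
    using V by (cases rule: Sigma_atlas_cases) auto
  obtain r s where s: "r > 0" "s holomorphic_on ball w r" "s w = y"
    "\<And>t. t \<in> ball w r \<Longrightarrow> (s t)\<^sup>2 = curve_poly t" "\<And>t. t \<in> ball w r \<Longrightarrow> s t \<noteq> 0"
    using curve_poly_sqrt_branch[OF Aff_in_chart[OF V] y] by metis
  note cont = holomorphic_on_ball_isCont[OF s(2,1)]
  have inv: "\<forall>\<^sub>F t in nhds w. inv_into V omega_fun t = Aff t (s t)"
    by (rule inv_into_omega_chart[OF V cont s(3) eventually_nhds_ball[OF s(1,4)]])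
  show ?thesis
    by (rule quadratic_form_eqI[where \<tau> = "\<lambda>t. Aff t (s t)" and D = "\<lambda>_. 1"
          and \<phi> = "\<lambda>t. (a + b * t + c * t\<^sup>2) / s t"])
      (use inv cont s(3) y in \<open>auto intro!: continuous_intros\<close>)
qed

text \<open>From y^2 = p(\<omega>) one gets d\<omega> = 2 y dy / p'(\<omega>); the factor y cancels
  the denominator of the form, so the coefficient stays finite at branch points.\<close>

lemma quadratic_form_y_chart:
  assumes V: "(V, y_fun) \<in> Sigma_atlas" "Aff w y \<in> V"
  shows "quadratic_form a b c (V, y_fun) (Aff w y) = 2 * (a + b * w + c * w\<^sup>2) / curve_poly' w"
proof -
  have w: "curve_poly' w \<noteq> 0"
    using V by (cases rule: Sigma_atlas_cases) auto
  obtain r \<rho> where \<rho>: "r > 0" "\<rho> holomorphic_on ball y r" "\<rho> y = w"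
    "\<And>t. t \<in> ball y r \<Longrightarrow> t\<^sup>2 = curve_poly (\<rho> t)"
    "\<And>t. t \<in> ball y r \<Longrightarrow> (\<rho> has_field_derivative 2 * t / curve_poly' (\<rho> t)) (at t)"
    using curve_poly_inverse_branch[OF Aff_in_chart[OF V] w] by metis
  note cont = holomorphic_on_ball_isCont[OF \<rho>(2,1)]
  have inv: "\<forall>\<^sub>F t in nhds y. inv_into V y_fun t = Aff (\<rho> t) t"
    by (rule inv_into_y_chart[OF V cont \<rho>(3) eventually_nhds_ball[OF \<rho>(1,4)]])
  have D: "\<forall>\<^sub>F t in at y. (\<rho> has_field_derivative 2 * t / curve_poly' (\<rho> t)) (at t)"
    using eventually_nhds_ball[OF \<rho>(1), of y "\<lambda>t. (\<rho> has_field_derivative 2 * t / curve_poly' (\<rho> t)) (at t)"] \<rho>(5)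
    unfolding eventually_nhds_conv_at by blast
  have nz: "\<forall>\<^sub>F t in at y. t \<noteq> 0"
    using eventually_neq_at_within[of 0] by blast
  have "isCont curve_poly' w"
    using holomorphic_on_ball_isCont[OF holomorphic_curve_poly(2), of 1] by simp
  then have cont': "isCont (\<lambda>t. curve_poly' (\<rho> t)) y"
    using isCont_o2[OF cont] \<rho>(3) by simp
  show ?thesis
  proof (rule quadratic_form_eqI[where \<tau> = "\<lambda>t. Aff (\<rho> t) t" and D = "\<lambda>t. 2 * t / curve_poly' (\<rho> t)"
          and \<phi> = "\<lambda>t. 2 * (a + b * \<rho> t + c * (\<rho> t)\<^sup>2) / curve_poly' (\<rho> t)"])
    show "isCont (\<lambda>t. 2 * (a + b * \<rho> t + c * (\<rho> t)\<^sup>2) / curve_poly' (\<rho> t)) (y_fun (Aff w y))"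
      using cont cont' w \<rho>(3) by (auto intro!: continuous_intros)
    show "\<forall>\<^sub>F t in at (y_fun (Aff w y)). (a + b * omega_fun (Aff (\<rho> t) t) + c * (omega_fun (Aff (\<rho> t) t))\<^sup>2) /
        y_fun (Aff (\<rho> t) t) * (2 * t / curve_poly' (\<rho> t)) =
        2 * (a + b * \<rho> t + c * (\<rho> t)\<^sup>2) / curve_poly' (\<rho> t)"
      using nz unfolding y_fun.simps omega_fun.simps by eventually_elim simp
  qed (use inv D \<rho>(3) in auto)
qed

text \<open>With \<omega> = 1/u, y = v/u^4 and d\<omega> = -du/u^2 the powers of u cancel exactly
  because the numerator has degree at most two. The sign comes from d\<omega>, and the order of the
  coefficients is reversed.\<close>

lemma quadratic_form_u_chart:
  assumes V: "(V, u_fun) \<in> Sigma_atlas" "patch_inf (u, v) \<in> V"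
  shows "quadratic_form a b c (V, u_fun) (patch_inf (u, v)) = - (a * u\<^sup>2 + b * u + c) / v"
    "v \<noteq> 0" "v\<^sup>2 = curve_poly u"
proof -
  show v: "v \<noteq> 0"
  proof (cases "u = 0")
    case True
    then have "Infty v \<in> V" using V(2) by (simp add: patch_inf.simps)
    then have "v\<^sup>2 = 1"
      using openin_subset[OF Sigma_atlasD(1)[OF V(1)]] mem_topspace_Sigma_surf(2) by blast
    then show ?thesis by auto
  next
    case False
    then have "Aff (1 / u) (v / u ^ 4) \<in> V" using V(2) by (simp add: patch_inf.simps)
    with V(1) show ?thesis by (cases rule: Sigma_atlas_cases) auto
  qed
  show sq: "v\<^sup>2 = curve_poly u"
  proof (cases "u = 0")
    case True
    then have "Infty v \<in> V" using V(2) by (simp add: patch_inf.simps)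
    then have "v\<^sup>2 = 1"
      using openin_subset[OF Sigma_atlasD(1)[OF V(1)]] mem_topspace_Sigma_surf(2) by blast
    then show ?thesis using True by (simp add: curve_poly_def)
  next
    case False
    then have "Aff (1 / u) (v / u ^ 4) \<in> V" using V(2) by (simp add: patch_inf.simps)
    from Aff_in_chart[OF V(1) this] False show ?thesis
      by (simp add: curve_poly_palindromic power_divide flip: power_mult)
  qed
  obtain r s where s: "r > 0" "s holomorphic_on ball u r" "s u = v"
    "\<And>t. t \<in> ball u r \<Longrightarrow> (s t)\<^sup>2 = curve_poly t" "\<And>t. t \<in> ball u r \<Longrightarrow> s t \<noteq> 0"
    using curve_poly_sqrt_branch[OF sq v] by metis
  note cont = holomorphic_on_ball_isCont[OF s(2,1)]
  have inv: "\<forall>\<^sub>F t in nhds u. inv_into V u_fun t = patch_inf (t, s t)"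
    by (rule inv_into_u_chart[OF V cont s(3) eventually_nhds_ball[OF s(1,4)]])
  have nz: "\<forall>\<^sub>F t in at u. t \<noteq> 0"
    using eventually_neq_at_within[of 0] by blast
  have om: "omega_fun (patch_inf (t, s t)) = 1 / t" for t by (simp add: patch_inf.simps)
  have yf: "y_fun (patch_inf (t, s t)) = (if t = 0 then 0 else s t / t ^ 4)" for t
    by (simp add: patch_inf.simps)
  show "quadratic_form a b c (V, u_fun) (patch_inf (u, v)) = - (a * u\<^sup>2 + b * u + c) / v"
  proof (rule quadratic_form_eqI[where \<tau> = "\<lambda>t. patch_inf (t, s t)" and D = "\<lambda>t. - 1 / t\<^sup>2"
          and \<phi> = "\<lambda>t. - (a * t\<^sup>2 + b * t + c) / s t"])
    show "\<forall>\<^sub>F t in at (u_fun (patch_inf (u, v))).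
        ((\<lambda>t. omega_fun (patch_inf (t, s t))) has_field_derivative - 1 / t\<^sup>2) (at t)"
      unfolding omega_y_u_patch om using nz
      by eventually_elim (auto intro!: derivative_eq_intros simp: power2_eq_square)
    show "\<forall>\<^sub>F t in at (u_fun (patch_inf (u, v))). (a + b * omega_fun (patch_inf (t, s t)) +
        c * (omega_fun (patch_inf (t, s t)))\<^sup>2) / y_fun (patch_inf (t, s t)) * (- 1 / t\<^sup>2) =
        - (a * t\<^sup>2 + b * t + c) / s t"
      unfolding omega_y_u_patch om yf using nz
      by eventually_elim (simp add: divide_simps power2_eq_square power4_eq_xxxx, simp add: algebra_simps)
    show "isCont (\<lambda>t. - (a * t\<^sup>2 + b * t + c) / s t) (u_fun (patch_inf (u, v)))"
      unfolding omega_y_u_patch using cont s(3) v by (auto intro!: continuous_intros)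
  qed (use inv s(3) in \<open>auto simp: omega_y_u_patch\<close>)
qed

section \<open>Local primitives of the forms\<close>

lemma isCont_eventually_compose:
  assumes "isCont f x" "\<forall>\<^sub>F t in nhds (f x). Q t"
  shows "\<forall>\<^sub>F t in nhds x. Q (f t)"
proof -
  have "filterlim f (nhds (f x)) (nhds x)"
    using assms(1) by (simp add: continuous_at tendsto_at_iff_tendsto_nhds)
  then show ?thesis using assms(2) unfolding filterlim_iff by blast
qed

text \<open>At a finite point with \<open>y \<noteq> 0\<close> it suffices to test a primitive in the coordinate \<open>\<omega>\<close>.\<close>

lemma primitive_at_regular_point:
  assumes V: "(V, z) \<in> Sigma_atlas" "Aff w y \<in> V" and y: "y \<noteq> 0"
    and s: "isCont s w" "s w = y" "\<forall>\<^sub>F t in nhds w. (s t)\<^sup>2 = curve_poly t"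
    and h: "\<forall>\<^sub>F t in nhds w. h (Aff t (s t)) = G t"
    and G: "(G has_field_derivative (a + b * w + c * w\<^sup>2) / y) (at w)"
  shows "((h \<circ> inv_into V z) has_field_derivative quadratic_form a b c (V, z) (Aff w y)) (at (z (Aff w y)))"
  using V(1)
proof (cases rule: Sigma_atlas_cases)
  case omega
  note V' = V[unfolded omega(1)]
  have "\<forall>\<^sub>F t in nhds w. (h \<circ> inv_into V omega_fun) t = G t"
    using inv_into_omega_chart[OF V' s] h by eventually_elim simp
  from iffD2[OF DERIV_cong_ev[OF refl this refl] G] show ?thesis
    unfolding omega(1) quadratic_form_omega_chart[OF V'] omega_fun.simps o_def .
next
  case y: y
  note V' = V[unfolded y(1)]
  have w: "curve_poly' w \<noteq> 0" using y(2) V(2) by auto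
  obtain r \<rho> where \<rho>: "r > 0" "\<rho> holomorphic_on ball y r" "\<rho> y = w"
    "\<And>t. t \<in> ball y r \<Longrightarrow> t\<^sup>2 = curve_poly (\<rho> t)"
    "\<And>t. t \<in> ball y r \<Longrightarrow> (\<rho> has_field_derivative 2 * t / curve_poly' (\<rho> t)) (at t)"
    using curve_poly_inverse_branch[OF Aff_in_chart[OF V] w] by metis
  have cont: "isCont \<rho> y" by (rule holomorphic_on_ball_isCont[OF \<rho>(2,1)])
  have ev: "\<forall>\<^sub>F t in nhds y. t\<^sup>2 = curve_poly (\<rho> t)"
    by (rule eventually_nhds_ball[OF \<rho>(1)]) (rule \<rho>(4))
  have "\<forall>\<^sub>F t in nhds y. (s (\<rho> t))\<^sup>2 = curve_poly (\<rho> t)"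
    by (rule isCont_eventually_compose[OF cont]) (simp add: \<rho>(3) s)
  with ev have "\<forall>\<^sub>F t in nhds y. (s (\<rho> t))\<^sup>2 = t\<^sup>2" by eventually_elim simp
  moreover have "isCont (\<lambda>t. s (\<rho> t)) y"
    by (rule isCont_o2[OF cont]) (simp add: \<rho>(3) s(1))
  \<comment> \<open>Both sides are continuous square roots of the polynomial at \<rho>(t) with the
    same nonzero value at \<open>y\<close>; hence the sections over \<omega> and over y trace the
    same points.\<close>
  ultimately have s\<rho>: "\<forall>\<^sub>F t in nhds y. s (\<rho> t) = t"
    using square_roots_eventually_eq[of y "\<lambda>t. s (\<rho> t)" "\<lambda>t. t"] assms(3) \<rho>(3) s(2) by simp
  have "\<forall>\<^sub>F t in nhds y. h (Aff (\<rho> t) (s (\<rho> t))) = G (\<rho> t)"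
    by (rule isCont_eventually_compose[OF cont]) (simp add: \<rho>(3) h)
  with inv_into_y_chart[OF V' cont \<rho>(3) ev] s\<rho>
  have eq: "\<forall>\<^sub>F t in nhds y. (h \<circ> inv_into V y_fun) t = G (\<rho> t)"
    by eventually_elim simp
  have d\<rho>: "(\<rho> has_field_derivative 2 * y / curve_poly' w) (at y)"
    using \<rho>(5)[of y] \<rho>(1,3) by simp
  have "((\<lambda>t. G (\<rho> t)) has_field_derivative (a + b * w + c * w\<^sup>2) / y * (2 * y / curve_poly' w)) (at y)"
    by (rule DERIV_chain2[OF _ d\<rho>]) (simp add: \<rho>(3) G)
  also have "(a + b * w + c * w\<^sup>2) / y * (2 * y / curve_poly' w) =
      quadratic_form a b c (V, y_fun) (Aff w y)"
    unfolding quadratic_form_y_chart[OF V'] using assms(3) by simp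
  finally show ?thesis
    unfolding y(1) y_fun.simps DERIV_cong_ev[OF refl eq refl] .
next
  case u
  note V' = V[unfolded u(1)]
  have w: "w \<noteq> 0" using u(2) V(2) by auto
  define u1 v1 where "u1 = 1 / w" and "v1 = y / w ^ 4"
  have u1: "u1 \<noteq> 0" "1 / u1 = w" "v1 / u1 ^ 4 = y" "u_fun (Aff w y) = u1"
    using w by (simp_all add: u1_def v1_def power_divide)
  then have patch: "patch_inf (u1, v1) = Aff w y" by (simp add: patch_inf.simps)
  have Vp: "patch_inf (u1, v1) \<in> V" using V(2) patch by simp
  obtain r \<tau> where \<tau>: "r > 0" "\<tau> holomorphic_on ball u1 r" "\<tau> u1 = v1"
    "\<And>t. t \<in> ball u1 r \<Longrightarrow> (\<tau> t)\<^sup>2 = curve_poly t"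
    using curve_poly_sqrt_branch[OF quadratic_form_u_chart(3,2)[OF V'(1) Vp]] by metis
  have cont: "isCont \<tau> u1" by (rule holomorphic_on_ball_isCont[OF \<tau>(2,1)])
  have ev: "\<forall>\<^sub>F t in nhds u1. (\<tau> t)\<^sup>2 = curve_poly t"
    by (rule eventually_nhds_ball[OF \<tau>(1)]) (rule \<tau>(4))
  have nz: "\<forall>\<^sub>F t in nhds u1. t \<noteq> 0"
    by (rule t1_space_nhds[OF u1(1)])
  have cinv: "isCont (\<lambda>t. 1 / t) u1" using u1(1) by (intro continuous_intros) auto
  have "\<forall>\<^sub>F t in nhds u1. (s (1 / t))\<^sup>2 = curve_poly (1 / t)"
    by (rule isCont_eventually_compose[OF cinv]) (simp only: u1(2) s(3))
  with ev nz have "\<forall>\<^sub>F t in nhds u1. (s (1 / t))\<^sup>2 = (\<tau> t / t ^ 4)\<^sup>2"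
    by eventually_elim (simp add: curve_poly_palindromic power_divide flip: power_mult)
  \<comment> \<open>The palindromic symmetry makes both sides square roots of the polynomial at 1/t,
    and they share the nonzero value \<open>y\<close> at \<open>u1\<close>.\<close>
  then have s\<tau>: "\<forall>\<^sub>F t in nhds u1. s (1 / t) = \<tau> t / t ^ 4"
  proof (rule square_roots_eventually_eq[rotated -1])
    show "isCont (\<lambda>t. s (1 / t)) u1" 
      by (rule isCont_o2[OF cinv]) (simp only: u1(2) s(1))
    show "isCont (\<lambda>t. \<tau> t / t ^ 4) u1" using cont u1(1) by (intro continuous_intros) auto
    show "s (1 / u1) = \<tau> u1 / u1 ^ 4" "s (1 / u1) \<noteq> 0"
      unfolding u1(2) \<tau>(3) u1(3) s(2) using y by simp_all
  qed
  have "\<forall>\<^sub>F t in nhds u1. h (Aff (1 / t) (s (1 / t))) = G (1 / t)"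
    by (rule isCont_eventually_compose[OF cinv]) (simp only: u1(2) h)
  with inv_into_u_chart[OF V'(1) Vp cont \<tau>(3) ev] s\<tau> nz
  have eq: "\<forall>\<^sub>F t in nhds u1. (h \<circ> inv_into V u_fun) t = G (1 / t)"
    by eventually_elim (simp add: patch_inf.simps)
  have du: "((\<lambda>t. 1 / t) has_field_derivative - 1 / u1\<^sup>2) (at u1)"
    using u1(1) by (auto intro!: derivative_eq_intros simp: power2_eq_square)
  have "((\<lambda>t. G (1 / t)) has_field_derivative (a + b * w + c * w\<^sup>2) / y * (- 1 / u1\<^sup>2)) (at u1)"
    by (rule DERIV_chain2[OF _ du]) (simp only: u1(2) G)
  also have "(a + b * w + c * w\<^sup>2) / y * (- 1 / u1\<^sup>2) = - (a * u1\<^sup>2 + b * u1 + c) / v1"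
    using w y by (simp add: u1_def v1_def divide_simps power2_eq_square power4_eq_xxxx; simp add: algebra_simps)
  also have "\<dots> = quadratic_form a b c (V, u_fun) (Aff w y)"
    unfolding patch[symmetric] using quadratic_form_u_chart(1)[OF V'(1) Vp] by simp
  finally show ?thesis
    unfolding u(1) u1(4) DERIV_cong_ev[OF refl eq refl] .
qed

section \<open>Disc neighbourhoods on the surface\<close>

lemma sqrt_branch_graph:
  assumes V: "openin Sigma_surf V" and \<pi>: "\<pi> = patch_zero \<or> \<pi> = patch_inf"
    and y: "y0\<^sup>2 = curve_poly w0" "y0 \<noteq> 0" and mem: "\<pi> (w0, y0) \<in> V"
  obtains r s where "r > 0" "s holomorphic_on ball w0 r" "s w0 = y0"
    "\<And>w. w \<in> ball w0 r \<Longrightarrow> (s w)\<^sup>2 = curve_poly w" "\<And>w. w \<in> ball w0 r \<Longrightarrow> s w \<noteq> 0"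
    "openin Sigma_surf ((\<lambda>w. \<pi> (w, s w)) ` ball w0 r)" "(\<lambda>w. \<pi> (w, s w)) ` ball w0 r \<subseteq> V"
proof -
  obtain r s where s: "r > 0" "s holomorphic_on ball w0 r" "s w0 = y0"
    "\<And>w. w \<in> ball w0 r \<Longrightarrow> (s w)\<^sup>2 = curve_poly w" "\<And>w. w \<in> ball w0 r \<Longrightarrow> s w \<noteq> 0"
    using curve_poly_sqrt_branch[OF y] by metis
  have "isCont s w0" by (rule holomorphic_on_ball_isCont[OF s(2,1)])
  then have "\<forall>\<^sub>F t in nhds w0. \<pi> (t, s t) \<in> V"
    by (intro eventually_patch_mem[OF V \<pi>] continuous_intros)
      (use eventually_nhds_ball[OF s(1,4)] mem s(3) in \<open>simp_all add: mem_affine_curve\<close>)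
  then obtain r' where r': "r' > 0" "\<And>t. dist t w0 < r' \<Longrightarrow> \<pi> (t, s t) \<in> V"
    unfolding eventually_nhds_metric by blast
  define R where "R = min r r'"
  have R: "R > 0" "ball w0 R \<subseteq> ball w0 r" using s(1) r'(1) by (auto simp: R_def)
  let ?D = "affine_curve \<inter> fst -` ball w0 R"
  \<comment> \<open>Over the ball the curve consists of the two sheets y = s(\<omega>) and y =
    -s(\<omega>). The open condition y + s(\<omega>) \<noteq> 0 removes exactly the second, which
    shows that the graph of \<open>s\<close> is open.\<close>
  let ?E = "?D \<inter> (\<lambda>q. snd q + s (fst q)) -` (- {0})"
  have D: "openin (top_of_set affine_curve) ?D"
    by (intro openin_open_Int open_vimage_fst) auto
  have "continuous_on ?D (\<lambda>q. s (fst q))"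
    by (rule continuous_on_compose2[OF holomorphic_on_imp_continuous_on[OF s(2)]])
      (use R(2) in \<open>auto intro!: continuous_intros\<close>)
  then have "openin (top_of_set ?D) ?E"
    by (intro continuous_openin_preimage_gen continuous_intros) auto
  then have E: "openin (top_of_set affine_curve) ?E" using D openin_trans by blast
  have "?E = (\<lambda>w. (w, s w)) ` ball w0 R"
  proof (intro equalityI subsetI)
    fix q assume q: "q \<in> ?E"
    then have "(snd q)\<^sup>2 = (s (fst q))\<^sup>2" using R(2) s(4) by (cases q) (auto simp: mem_affine_curve)
    then have "snd q = s (fst q)" using q by (auto simp: power2_eq_iff)
    then show "q \<in> (\<lambda>w. (w, s w)) ` ball w0 R" using q by (cases q) auto
  next
    fix q assume "q \<in> (\<lambda>w. (w, s w)) ` ball w0 R"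
    then show "q \<in> ?E" using R(2) s(4,5) by (auto simp: mem_affine_curve)
  qed
  then have "\<pi> ` ?E = (\<lambda>w. \<pi> (w, s w)) ` ball w0 R" by (simp add: image_image)
  then have "openin Sigma_surf ((\<lambda>w. \<pi> (w, s w)) ` ball w0 R)"
    using \<pi> openin_patch_zero_image[OF E] openin_patch_inf_image[OF E] by auto
  moreover have "(\<lambda>w. \<pi> (w, s w)) ` ball w0 R \<subseteq> V"
    using r'(2) by (auto simp: R_def dist_commute)
  ultimately show thesis
    using that[of R s] R s holomorphic_on_subset[OF s(2) R(2)] by blast
qed

lemma inverse_branch_graph:
  assumes V: "openin Sigma_surf V"
    and y: "y0\<^sup>2 = curve_poly w0" "curve_poly' w0 \<noteq> 0" and mem: "Aff w0 y0 \<in> V"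
  obtains r \<rho> where "r > 0" "\<rho> holomorphic_on ball y0 r" "\<rho> y0 = w0"
    "\<And>y. y \<in> ball y0 r \<Longrightarrow> y\<^sup>2 = curve_poly (\<rho> y)" "\<And>y. y \<in> ball y0 r \<Longrightarrow> curve_poly' (\<rho> y) \<noteq> 0"
    "openin Sigma_surf ((\<lambda>y. Aff (\<rho> y) y) ` ball y0 r)" "(\<lambda>y. Aff (\<rho> y) y) ` ball y0 r \<subseteq> V"
proof -
  obtain r \<rho> N where \<rho>: "r > 0" "\<rho> holomorphic_on ball y0 r" "\<rho> y0 = w0"
    "\<And>y. y \<in> ball y0 r \<Longrightarrow> y\<^sup>2 = curve_poly (\<rho> y)" "\<And>y. y \<in> ball y0 r \<Longrightarrow> curve_poly' (\<rho> y) \<noteq> 0"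
    and N: "open N" "inj_on curve_poly N" "\<And>y. y \<in> ball y0 r \<Longrightarrow> \<rho> y \<in> N"
    using curve_poly_inverse_branch[OF y] by metis
  have "isCont \<rho> y0" by (rule holomorphic_on_ball_isCont[OF \<rho>(2,1)])
  then have "\<forall>\<^sub>F t in nhds y0. patch_zero (\<rho> t, t) \<in> V"
    by (intro eventually_patch_mem[OF V] continuous_intros)
      (use eventually_nhds_ball[OF \<rho>(1,4)] mem \<rho>(3) in \<open>simp_all add: mem_affine_curve patch_zero.simps\<close>)
  then obtain r' where r': "r' > 0" "\<And>t. dist t y0 < r' \<Longrightarrow> patch_zero (\<rho> t, t) \<in> V"
    unfolding eventually_nhds_metric by blast
  define R where "R = min r r'"
  have R: "R > 0" "ball y0 R \<subseteq> ball y0 r" using \<rho>(1) r'(1) by (auto simp: R_def)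
  \<comment> \<open>Injectivity of the polynomial on \<open>N\<close> leaves only one \<omega> for
    each y, so this visibly open set is the graph of \<rho>.\<close>
  let ?E = "affine_curve \<inter> (N \<times> ball y0 R)"
  have E: "openin (top_of_set affine_curve) ?E"
    by (intro openin_open_Int open_Times N(1) open_ball)
  have "?E = (\<lambda>y. (\<rho> y, y)) ` ball y0 R"
  proof (intro equalityI subsetI)
    fix q assume q: "q \<in> ?E"
    then have *: "snd q \<in> ball y0 r" "fst q \<in> N" "(snd q)\<^sup>2 = curve_poly (fst q)"
      using R(2) by (cases q; auto simp: mem_affine_curve)+
    then have "curve_poly (fst q) = curve_poly (\<rho> (snd q))" using \<rho>(4) by metis
    then have "fst q = \<rho> (snd q)" using inj_onD[OF N(2)] * N(3) by blast
    then show "q \<in> (\<lambda>y. (\<rho> y, y)) ` ball y0 R" using q by (cases q) auto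
  next
    fix q assume "q \<in> (\<lambda>y. (\<rho> y, y)) ` ball y0 R"
    then show "q \<in> ?E" using R(2) \<rho>(4) N(3) by (auto simp: mem_affine_curve)
  qed
  then have "patch_zero ` ?E = (\<lambda>y. Aff (\<rho> y) y) ` ball y0 R" by (simp add: image_image patch_zero.simps)
  then have "openin Sigma_surf ((\<lambda>y. Aff (\<rho> y) y) ` ball y0 R)"
    using openin_patch_zero_image[OF E] by simp
  moreover have "(\<lambda>y. Aff (\<rho> y) y) ` ball y0 R \<subseteq> V"
    using r'(2) by (auto simp: R_def dist_commute patch_zero.simps)
  ultimately show thesis
    using that[of R \<rho>] R \<rho> holomorphic_on_subset[OF \<rho>(2) R(2)] by blast
qed

lemma Sigma_point_cases:
  assumes "p \<in> topspace Sigma_surf"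
  obtains (regular) w y where "p = Aff w y" "y\<^sup>2 = curve_poly w" "y \<noteq> 0"
    | (branch) w where "p = Aff w 0" "0\<^sup>2 = curve_poly w" "curve_poly' w \<noteq> 0"
    | (infinite) v where "p = patch_inf (0, v)" "v\<^sup>2 = curve_poly 0" "v \<noteq> 0"
proof (cases p)
  case (Aff w y)
  then have "y\<^sup>2 = curve_poly w"
    using assms by (simp add: mem_topspace_Sigma_surf mem_affine_curve)
  then show thesis
    using that(1,2) Aff curve_poly_simple_roots by (cases "y = 0") auto
next
  case (Infty v)
  then have "v\<^sup>2 = 1" using assms by (simp add: mem_topspace_Sigma_surf)
  moreover from this have "v \<noteq> 0" by auto
  ultimately show thesis
    using that(3)[of v] Infty by (simp add: patch_inf.simps curve_poly_def)
qed

lemma Sigma_atlasI: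
  assumes "openin Sigma_surf V"
  shows "\<lbrakk>inj_on omega_fun V; V \<subseteq> {Aff w y | w y. y \<noteq> 0}\<rbrakk> \<Longrightarrow> (V, omega_fun) \<in> Sigma_atlas"
    "\<lbrakk>inj_on y_fun V; V \<subseteq> {Aff w y | w y. curve_poly' w \<noteq> 0}\<rbrakk> \<Longrightarrow> (V, y_fun) \<in> Sigma_atlas"
    "\<lbrakk>inj_on u_fun V; V \<subseteq> {Aff w y | w y. w \<noteq> 0 \<and> y \<noteq> 0} \<union> range Infty\<rbrakk> \<Longrightarrow> (V, u_fun) \<in> Sigma_atlas"
  using assms unfolding Sigma_atlas_def curve_poly'_def by blast+

text \<open>The image has to be a full disc because its connectedness is used to conclude that a
  function with zero derivative is constant. The chart domain is the graph of a branch over the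
  disc.\<close>

lemma disc_chart_exists:
  assumes O: "openin Sigma_surf S" and p: "p \<in> S"
  obtains V z r where "(V, z) \<in> Sigma_atlas" "p \<in> V" "V \<subseteq> S" "r > 0" "z ` V = ball (z p) r"
proof -
  have graph: "inj_on z (f ` ball x r) \<and> z ` f ` ball x r = ball x r \<and> (r > 0 \<longrightarrow> f x \<in> f ` ball x r)"
    if "\<And>t. z (f t) = t" for z :: "curve_point \<Rightarrow> complex" and f x and r :: real
    using that by (auto simp: inj_on_def image_image)
  have "p \<in> topspace Sigma_surf" using openin_subset[OF O] p by blast
  then show thesis
  proof (cases rule: Sigma_point_cases)
    case (regular w y)
    then have "patch_zero (w, y) \<in> S" using p by (simp add: patch_zero.simps)
    from sqrt_branch_graph[OF O disjI1[OF refl] regular(2,3) this]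
    obtain r s where s: "r > 0" "s w = y" "\<And>t. t \<in> ball w r \<Longrightarrow> s t \<noteq> 0"
      "openin Sigma_surf ((\<lambda>t. patch_zero (t, s t)) ` ball w r)" "(\<lambda>t. patch_zero (t, s t)) ` ball w r \<subseteq> S"
      by blast
    have p_eq: "p = patch_zero (w, s w)" "omega_fun p = w" using regular(1) s(2) by (simp_all add: patch_zero.simps)
    note gr = graph[of omega_fun "\<lambda>t. patch_zero (t, s t)" w r, OF omega_y_u_patch(1)]
    have "(\<lambda>t. patch_zero (t, s t)) ` ball w r \<subseteq> {Aff w y | w y. y \<noteq> 0}"
      unfolding patch_zero.simps using s(3) by blast
    then show thesis
      using that[OF Sigma_atlasI(1)[OF s(4)] _ s(5,1)] gr s(1) p_eq by simp
  next
    case (branch w)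
    from inverse_branch_graph[OF O branch(2,3) p[unfolded branch(1)]]
    obtain r \<rho> where \<rho>: "r > 0" "\<rho> 0 = w" "\<And>y. y \<in> ball 0 r \<Longrightarrow> curve_poly' (\<rho> y) \<noteq> 0"
      "openin Sigma_surf ((\<lambda>y. Aff (\<rho> y) y) ` ball 0 r)" "(\<lambda>y. Aff (\<rho> y) y) ` ball 0 r \<subseteq> S"
      by blast
    have p_eq: "p = Aff (\<rho> 0) 0" "y_fun p = 0" using branch(1) \<rho>(2) by simp_all
    note gr = graph[of y_fun "\<lambda>y. Aff (\<rho> y) y" 0 r, OF y_fun.simps(1)]
    have "(\<lambda>y. Aff (\<rho> y) y) ` ball 0 r \<subseteq> {Aff w y | w y. curve_poly' w \<noteq> 0}"
      using \<rho>(3) by blast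
    then show thesis
      using that[OF Sigma_atlasI(2)[OF \<rho>(4)] _ \<rho>(5,1)] gr \<rho>(1) p_eq by simp
  next
    case (infinite v)
    from sqrt_branch_graph[OF O disjI2[OF refl] infinite(2,3) p[unfolded infinite(1)]]
    obtain r s where s: "r > 0" "s 0 = v" "\<And>t. t \<in> ball 0 r \<Longrightarrow> s t \<noteq> 0"
      "openin Sigma_surf ((\<lambda>t. patch_inf (t, s t)) ` ball 0 r)" "(\<lambda>t. patch_inf (t, s t)) ` ball 0 r \<subseteq> S"
      by blast
    have p_eq: "p = patch_inf (0, s 0)" "u_fun p = 0"
      using infinite(1) s(2) by (simp_all add: omega_y_u_patch)
    note gr = graph[of u_fun "\<lambda>t. patch_inf (t, s t)" 0 r, OF omega_y_u_patch(3)]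
    have "patch_inf (t, s t) \<in> {Aff w y | w y. w \<noteq> 0 \<and> y \<noteq> 0} \<union> range Infty" if "t \<in> ball 0 r" for t
      using s(3)[OF that] by (simp add: patch_inf.simps)
    then have "(\<lambda>t. patch_inf (t, s t)) ` ball 0 r \<subseteq> {Aff w y | w y. w \<noteq> 0 \<and> y \<noteq> 0} \<union> range Infty"
      by blast
    then show thesis
      using that[OF Sigma_atlasI(3)[OF s(4)] _ s(5,1)] gr s(1) p_eq by simp
  qed
qed

lemma holomorphic_primitive_on_ball:
  assumes "f holomorphic_on ball x r"
  obtains H where "\<And>t. t \<in> ball x r \<Longrightarrow> (H has_field_derivative f t) (at t)"
  using holomorphic_convex_primitive'[OF convex_ball open_ball assms] at_within_open[OF _ open_ball] by metis

text \<open>The coefficient in the natural coordinate of the point is holomorphic on a disc and has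
  a primitive \<open>H\<close> there. It remains to test \<open>H\<close> in every chart meeting the
  disc: regular points reduce to the coordinate \<omega>, and only the centre of a branch disc or of
  a disc at infinity needs its own argument.\<close>

lemma quadratic_form_has_primitives:
  assumes p: "p \<in> topspace Sigma_surf"
  shows "\<exists>U h. local_primitive Sigma_surf Sigma_atlas (quadratic_form a b c) U h \<and> p \<in> U"
  using p
proof (cases rule: Sigma_point_cases)
  case (regular w0 y0)
  have mem: "patch_zero (w0, y0) \<in> topspace Sigma_surf"
    using p regular(1) by (simp add: patch_zero.simps)
  obtain r s where s: "r > 0" "s holomorphic_on ball w0 r" "s w0 = y0"
    "\<And>w. w \<in> ball w0 r \<Longrightarrow> (s w)\<^sup>2 = curve_poly w" "\<And>w. w \<in> ball w0 r \<Longrightarrow> s w \<noteq> 0"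
    "openin Sigma_surf ((\<lambda>w. patch_zero (w, s w)) ` ball w0 r)"
    using sqrt_branch_graph[OF openin_topspace disjI1[OF refl] regular(2,3) mem] by blast
  have "(\<lambda>w. (a + b * w + c * w\<^sup>2) / s w) holomorphic_on ball w0 r"
    using s(2,5) by (intro holomorphic_intros) auto
  then obtain H where H: "\<And>w. w \<in> ball w0 r \<Longrightarrow> (H has_field_derivative (a + b * w + c * w\<^sup>2) / s w) (at w)"
    by (rule holomorphic_primitive_on_ball) blast
  let ?U = "(\<lambda>w. patch_zero (w, s w)) ` ball w0 r"
  have "((H \<circ> omega_fun \<circ> inv_into V z) has_field_derivative quadratic_form a b c (V, z) q) (at (z q))"
    if V: "(V, z) \<in> Sigma_atlas" and q: "q \<in> ?U" "q \<in> V" for V z q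
  proof -
    obtain w where w: "w \<in> ball w0 r" "q = Aff w (s w)" using q(1) by (auto simp: patch_zero.simps)
    have near: "\<forall>\<^sub>F t in nhds w. t \<in> ball w0 r" using w(1) by (intro eventually_nhds_in_open) auto
    have "isCont s w"
      using continuous_on_interior[OF holomorphic_on_imp_continuous_on[OF s(2)]] w(1) by simp
    moreover have "\<forall>\<^sub>F t in nhds w. (s t)\<^sup>2 = curve_poly t"
      using near by eventually_elim (rule s(4))
    moreover have "\<forall>\<^sub>F t in nhds w. (H \<circ> omega_fun) (Aff t (s t)) = H t" by simp
    ultimately show ?thesis
      unfolding w(2)
      using primitive_at_regular_point[where s = s and h = "H \<circ> omega_fun" and G = H,
          OF V q(2)[unfolded w(2)] s(5)[OF w(1)] _ refl] H[OF w(1)] by blast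
  qed
  then have "local_primitive Sigma_surf Sigma_atlas (quadratic_form a b c) ?U (H \<circ> omega_fun)"
    unfolding local_primitive_def using s(6) by blast
  moreover have "p \<in> ?U"
    using s(1,3) regular(1) by (auto simp: patch_zero.simps intro!: image_eqI[of _ _ w0])
  ultimately show ?thesis by blast
next
  case (branch w0)
  obtain r \<rho> where \<rho>: "r > 0" "\<rho> holomorphic_on ball 0 r" "\<rho> 0 = w0"
    "\<And>y. y \<in> ball 0 r \<Longrightarrow> y\<^sup>2 = curve_poly (\<rho> y)" "\<And>y. y \<in> ball 0 r \<Longrightarrow> curve_poly' (\<rho> y) \<noteq> 0"
    "openin Sigma_surf ((\<lambda>y. Aff (\<rho> y) y) ` ball 0 r)"
    using inverse_branch_graph[OF openin_topspace branch(2,3) p[unfolded branch(1)]] by blast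
  have "(\<lambda>y. 2 * (a + b * \<rho> y + c * (\<rho> y)\<^sup>2) / curve_poly' (\<rho> y)) holomorphic_on ball 0 r"
    using \<rho>(2,5) unfolding curve_poly'_def by (intro holomorphic_intros) auto
  then obtain H where H: "\<And>y. y \<in> ball 0 r \<Longrightarrow>
      (H has_field_derivative 2 * (a + b * \<rho> y + c * (\<rho> y)\<^sup>2) / curve_poly' (\<rho> y)) (at y)"
    by (rule holomorphic_primitive_on_ball) blast
  let ?U = "(\<lambda>y. Aff (\<rho> y) y) ` ball 0 r"
  have "((H \<circ> y_fun \<circ> inv_into V z) has_field_derivative quadratic_form a b c (V, z) q) (at (z q))"
    if V: "(V, z) \<in> Sigma_atlas" and q: "q \<in> ?U" "q \<in> V" for V z q
  proof -
    obtain y where y: "y \<in> ball 0 r" "q = Aff (\<rho> y) y" using q(1) by auto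
    have near: "\<forall>\<^sub>F t in nhds y. t \<in> ball 0 r" using y(1) by (intro eventually_nhds_in_open) auto
    have cont: "isCont \<rho> y"
      using continuous_on_interior[OF holomorphic_on_imp_continuous_on[OF \<rho>(2)]] y(1) by simp
    note qV = q(2)[unfolded y(2)]
    show ?thesis
    proof (cases "y = 0")
      case True
      \<comment> \<open>Charts in \<omega> and in u exclude finite points with y = 0, so no other
        coordinate occurs here.\<close>
      have z: "z = y_fun" using V qV True by (cases rule: Sigma_atlas_cases) auto
      have "\<forall>\<^sub>F t in nhds y. t\<^sup>2 = curve_poly (\<rho> t)"
        using near by eventually_elim (rule \<rho>(4))
      from inv_into_y_chart[OF V[unfolded z] qV cont refl this]
      have "\<forall>\<^sub>F t in nhds y. (H \<circ> y_fun \<circ> inv_into V y_fun) t = H t"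
        by eventually_elim simp
      from iffD2[OF DERIV_cong_ev[OF refl this refl] H[OF y(1)]] show ?thesis
        unfolding z y(2) quadratic_form_y_chart[OF V[unfolded z] qV] y_fun.simps o_def .
    next
      case False
      \<comment> \<open>Off the branch point \<omega> is a coordinate again: along the branch
        \<open>s\<close> the primitive becomes H(s(\<omega>)), and dy/d\<omega> = p'(\<omega>)/(2y)
        converts the derivative into the \<omega>-coefficient.\<close>
      obtain r' s where s: "r' > 0" "s holomorphic_on ball (\<rho> y) r'" "s (\<rho> y) = y"
        "\<And>w. w \<in> ball (\<rho> y) r' \<Longrightarrow> (s w)\<^sup>2 = curve_poly w"
        "\<And>w. w \<in> ball (\<rho> y) r' \<Longrightarrow> (s has_field_derivative curve_poly' w / (2 * s w)) (at w)"
        using curve_poly_sqrt_branch[OF \<rho>(4)[OF y(1)] False] by metis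
      have "(s has_field_derivative curve_poly' (\<rho> y) / (2 * y)) (at (\<rho> y))"
        using s(5)[of "\<rho> y"] s(1,3) by simp
      from DERIV_chain2[OF _ this, of H] H[OF y(1)]
      have "((\<lambda>w. H (s w)) has_field_derivative
          2 * (a + b * \<rho> y + c * (\<rho> y)\<^sup>2) / curve_poly' (\<rho> y) * (curve_poly' (\<rho> y) / (2 * y))) (at (\<rho> y))"
        unfolding s(3) by blast
      also have "2 * (a + b * \<rho> y + c * (\<rho> y)\<^sup>2) / curve_poly' (\<rho> y) * (curve_poly' (\<rho> y) / (2 * y)) =
          (a + b * \<rho> y + c * (\<rho> y)\<^sup>2) / y"
        using \<rho>(5)[OF y(1)] False by (simp add: field_simps)
      finally have G: "((\<lambda>w. H (s w)) has_field_derivative (a + b * \<rho> y + c * (\<rho> y)\<^sup>2) / y) (at (\<rho> y))" .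
      show ?thesis
        unfolding y(2)
        by (rule primitive_at_regular_point[OF V qV False holomorphic_on_ball_isCont[OF s(2,1)] s(3)
              eventually_nhds_ball[OF s(1,4)] _ G]) simp_all
    qed
  qed
  then have "local_primitive Sigma_surf Sigma_atlas (quadratic_form a b c) ?U (H \<circ> y_fun)"
    unfolding local_primitive_def using \<rho>(6) by blast
  moreover have "p \<in> ?U"
    using \<rho>(1,3) branch(1) by (auto intro!: image_eqI[of _ _ 0])
  ultimately show ?thesis by blast
next
  case (infinite v0)
  obtain r s where s: "r > 0" "s holomorphic_on ball 0 r" "s 0 = v0"
    "\<And>w. w \<in> ball 0 r \<Longrightarrow> (s w)\<^sup>2 = curve_poly w" "\<And>w. w \<in> ball 0 r \<Longrightarrow> s w \<noteq> 0"
    "openin Sigma_surf ((\<lambda>w. patch_inf (w, s w)) ` ball 0 r)"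
    using sqrt_branch_graph[OF openin_topspace disjI2[OF refl] infinite(2,3) p[unfolded infinite(1)]] by blast
  have "(\<lambda>u. - (a * u\<^sup>2 + b * u + c) / s u) holomorphic_on ball 0 r"
    using s(2,5) by (intro holomorphic_intros) auto
  then obtain H where H: "\<And>u. u \<in> ball 0 r \<Longrightarrow> (H has_field_derivative - (a * u\<^sup>2 + b * u + c) / s u) (at u)"
    by (rule holomorphic_primitive_on_ball) blast
  let ?U = "(\<lambda>u. patch_inf (u, s u)) ` ball 0 r"
  have "((H \<circ> u_fun \<circ> inv_into V z) has_field_derivative quadratic_form a b c (V, z) q) (at (z q))"
    if V: "(V, z) \<in> Sigma_atlas" and q: "q \<in> ?U" "q \<in> V" for V z q
  proof -
    obtain u where u: "u \<in> ball 0 r" "q = patch_inf (u, s u)" using q(1) by auto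
    have near: "\<forall>\<^sub>F t in nhds u. t \<in> ball 0 r" using u(1) by (intro eventually_nhds_in_open) auto
    note qV = q(2)[unfolded u(2)]
    show ?thesis
    proof (cases "u = 0")
      case True
      have z: "z = u_fun"
        using V qV True by (cases rule: Sigma_atlas_cases) (auto simp: patch_inf.simps)
      have "isCont s u"
        using continuous_on_interior[OF holomorphic_on_imp_continuous_on[OF s(2)]] u(1) by simp
      moreover have "\<forall>\<^sub>F t in nhds u. (s t)\<^sup>2 = curve_poly t"
        using near by eventually_elim (rule s(4))
      ultimately have "\<forall>\<^sub>F t in nhds u. inv_into V u_fun t = patch_inf (t, s t)"
        by (rule inv_into_u_chart[where s = s, OF V[unfolded z] qV _ refl])
      then have "\<forall>\<^sub>F t in nhds u. (H \<circ> u_fun \<circ> inv_into V u_fun) t = H t"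
        by eventually_elim (simp add: omega_y_u_patch)
      from iffD2[OF DERIV_cong_ev[OF refl this refl] H[OF u(1)]] show ?thesis
        unfolding z u(2) quadratic_form_u_chart(1)[OF V[unfolded z] qV] omega_y_u_patch o_def .
    next
      case False
      \<comment> \<open>The point is finite when u is nonzero; in the coordinate \<omega> the
        primitive reads H(1/\<omega>).\<close>
      define w y where "w = 1 / u" and "y = s u / u ^ 4"
      have w: "w \<noteq> 0" "1 / w = u" and y: "y \<noteq> 0"
        using False s(5)[OF u(1)] by (simp_all add: w_def y_def)
      have eq: "patch_inf (u, s u) = Aff w y" using False by (simp add: patch_inf.simps w_def y_def)
      have sq: "y\<^sup>2 = curve_poly w"
        using Aff_in_chart[OF V] qV eq by metis
      obtain r' s' where s': "r' > 0" "s' holomorphic_on ball w r'" "s' w = y"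
        "\<And>t. t \<in> ball w r' \<Longrightarrow> (s' t)\<^sup>2 = curve_poly t"
        using curve_poly_sqrt_branch[OF sq y] by metis
      have "((\<lambda>t. 1 / t) has_field_derivative - 1 / w\<^sup>2) (at w)"
        using w(1) by (auto intro!: derivative_eq_intros simp: power2_eq_square)
      from DERIV_chain2[OF _ this, of H] H[OF u(1)]
      have "((\<lambda>t. H (1 / t)) has_field_derivative
          - (a * u\<^sup>2 + b * u + c) / s u * (- 1 / w\<^sup>2)) (at w)"
        unfolding w(2) by blast
      also have "- (a * u\<^sup>2 + b * u + c) / s u * (- 1 / w\<^sup>2) = (a + b * w + c * w\<^sup>2) / y"
        using False s(5)[OF u(1)]
        by (simp add: w_def y_def divide_simps power2_eq_square power4_eq_xxxx, simp add: algebra_simps)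
      finally have G: "((\<lambda>t. H (1 / t)) has_field_derivative (a + b * w + c * w\<^sup>2) / y) (at w)" .
      show ?thesis
        unfolding u(2) eq
        by (rule primitive_at_regular_point[OF V qV[unfolded eq] y holomorphic_on_ball_isCont[OF s'(2,1)] s'(3)
              eventually_nhds_ball[OF s'(1,4)] _ G]) simp_all
    qed
  qed
  then have "local_primitive Sigma_surf Sigma_atlas (quadratic_form a b c) ?U (H \<circ> u_fun)"
    unfolding local_primitive_def using s(6) by blast
  moreover have "p \<in> ?U"
    using s(1,3) infinite(1) by (auto intro!: image_eqI[of _ _ 0])
  ultimately show ?thesis by blast
qed

text \<open>In a disc chart inside both domains the difference of two primitives has derivative
  zero. Only existence of primitives therefore depends on the form.\<close>

lemma closed_form_Sigma:
  assumes "\<And>p. p \<in> topspace Sigma_surf \<Longrightarrow> \<exists>U h. local_primitive Sigma_surf Sigma_atlas \<Phi> U h \<and> p \<in> U"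
  shows "closed_form Sigma_surf Sigma_atlas \<Phi>"
proof
  fix U1 h1 U2 h2 p
  assume h: "local_primitive Sigma_surf Sigma_atlas \<Phi> U1 h1" "local_primitive Sigma_surf Sigma_atlas \<Phi> U2 h2"
    and p: "p \<in> U1" "p \<in> U2"
  have "openin Sigma_surf (U1 \<inter> U2)" using h unfolding local_primitive_def by blast
  then obtain V z r where V: "(V, z) \<in> Sigma_atlas" "p \<in> V" "V \<subseteq> U1 \<inter> U2" "r > 0" "z ` V = ball (z p) r"
    using disc_chart_exists[of "U1 \<inter> U2" p] p by blast
  let ?d = "\<lambda>w. h1 (inv_into V z w) - h2 (inv_into V z w)"
  have "(?d has_field_derivative 0) (at w)" if "w \<in> ball (z p) r" for w
  proof -
    have "w \<in> z ` V" using that V(5) by simp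
    then obtain q where q: "q \<in> V" "w = z q" by blast
    have "((h1 \<circ> inv_into V z) has_field_derivative \<Phi> (V, z) q) (at (z q))"
      "((h2 \<circ> inv_into V z) has_field_derivative \<Phi> (V, z) q) (at (z q))"
      using h V(1,3) q(1) unfolding local_primitive_def by blast+
    from DERIV_diff[OF this] show ?thesis by (simp add: o_def q(2))
  qed
  then have "?d constant_on ball (z p) r"
    by (intro has_field_derivative_0_imp_constant_on) auto
  then obtain k where k: "\<And>w. w \<in> ball (z p) r \<Longrightarrow> ?d w = k"
    unfolding constant_on_def by blast
  have "h1 q - h2 q = k" if "q \<in> V" for q
  proof -
    have "z q \<in> ball (z p) r" using that V(5) by blast
    from k[OF this] show ?thesis using inv_into_f_f[OF Sigma_atlasD(2)[OF V(1)] that] by simp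
  qed
  then show "\<exists>W. openin Sigma_surf W \<and> p \<in> W \<and> (\<forall>q\<in>W. h1 q - h2 q = h1 p - h2 p)"
    using Sigma_atlasD(1)[OF V(1)] V(2) by metis
qed (rule assms)

lemma closed_form_quadratic_form: "closed_form Sigma_surf Sigma_atlas (quadratic_form a b c)"
  using closed_form_Sigma quadratic_form_has_primitives by blast

section \<open>The automorphism\<close>

lemma u_chart_point:
  assumes "(V, u_fun) \<in> Sigma_atlas" "p \<in> V"
  obtains u v where "p = patch_inf (u, v)"
proof (cases p)
  case (Aff w y)
  have "w \<noteq> 0" using assms(1) assms(2) Aff by (cases rule: Sigma_atlas_cases) auto
  then have "p = patch_inf (1 / w, y / w ^ 4)" using Aff by (simp add: patch_inf.simps power_divide)
  then show thesis by (rule that)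
next
  case (Infty v)
  then have "p = patch_inf (0, v)" by (simp add: patch_inf.simps)
  then show thesis by (rule that)
qed

text \<open>Chart domains are arbitrary open sets with an injective coordinate, and
  \<open>inv_into V z t\<close> is meaningful only for \<open>t\<close> in the image. Local branches
  inside \<open>V\<close> show that the image is a neighbourhood of each of its points.\<close>

lemma chart_image_nhds:
  assumes V: "(V, z) \<in> Sigma_atlas" and p: "p \<in> V"
  shows "\<forall>\<^sub>F t in nhds (z p). t \<in> z ` V"
proof -
  note O = Sigma_atlasD(1)[OF V]
  have graph: "\<forall>\<^sub>F t in nhds (z p). t \<in> z ` V"
    if "r > 0" "f ` ball (z p) r \<subseteq> V" "\<And>t. z (f t) = t" for f r
  proof (rule eventually_nhds_ball[OF that(1)])
    fix t assume "t \<in> ball (z p) r"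
    then have "f t \<in> V" using that(2) by blast
    then have "z (f t) \<in> z ` V" by (rule imageI)
    then show "t \<in> z ` V" unfolding that(3) .
  qed
  from V show ?thesis
  proof (cases rule: Sigma_atlas_cases)
    case omega
    then obtain w y where wy: "p = Aff w y" "y \<noteq> 0" using p by blast
    have zp: "z p = w" using omega wy by simp
    have mem: "patch_zero (w, y) \<in> V" using p wy(1) by (simp add: patch_zero.simps)
    have sq: "y\<^sup>2 = curve_poly w" using Aff_in_chart[OF V] p wy(1) by blast
    from sqrt_branch_graph[OF O disjI1[OF refl] sq wy(2) mem]
    obtain r s where "r > 0" "(\<lambda>t. patch_zero (t, s t)) ` ball w r \<subseteq> V" by blast
    then show ?thesis using graph[of r "\<lambda>t. patch_zero (t, s t)"] zp omega(1) omega_y_u_patch(1) by simp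
  next
    case y
    then obtain w y where wy: "p = Aff w y" "curve_poly' w \<noteq> 0" using p by blast
    have zp: "z p = y" using y(1) wy by simp
    have sq: "y\<^sup>2 = curve_poly w" using Aff_in_chart[OF V] p wy(1) by blast
    from inverse_branch_graph[OF O sq wy(2) p[unfolded wy(1)]]
    obtain r \<rho> where "r > 0" "(\<lambda>t. Aff (\<rho> t) t) ` ball y r \<subseteq> V" by blast
    then show ?thesis using graph[of r "\<lambda>t. Aff (\<rho> t) t"] zp y(1) by simp
  next
    case u
    obtain u1 v where uv: "p = patch_inf (u1, v)" by (rule u_chart_point[OF V[unfolded u(1)] p])
    have zp: "z p = u1" using u(1) uv omega_y_u_patch(3) by simp
    note mem = p[unfolded uv]
    from sqrt_branch_graph[OF O disjI2[OF refl] quadratic_form_u_chart(3,2)[OF V[unfolded u(1)] mem] mem]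
    obtain r s where "r > 0" "(\<lambda>t. patch_inf (t, s t)) ` ball u1 r \<subseteq> V" by blast
    then show ?thesis using graph[of r "\<lambda>t. patch_inf (t, s t)"] zp u(1) omega_y_u_patch(3) by simp
  qed
qed

text \<open>The cube serves as the inverse of the automorphism, so its continuity follows from that
  of the iterates.\<close>

lemma sigma_aut_cubed:
  "sigma_aut ((sigma_aut ^^ 3) p) = p" "(sigma_aut ^^ 3) (sigma_aut p) = p"
  using sigma_aut_order_4[of p] by (simp_all add: numeral_eq_Suc)

lemma continuous_map_sigma_aut_funpow: "continuous_map Sigma_surf Sigma_surf (sigma_aut ^^ n)"
  by (induction n) (simp_all add: continuous_map_compose[OF _ continuous_map_sigma_aut] del: o_apply)

lemma openin_sigma_aut_funpow_preimage:
  "openin Sigma_surf U \<Longrightarrow> openin Sigma_surf {p \<in> topspace Sigma_surf. (sigma_aut ^^ n) p \<in> U}"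
  using continuous_map_sigma_aut_funpow[of n] unfolding continuous_map_def by blast

text \<open>Each coordinate is an eigenfunction of the automorphism: \<omega>, y and u are
  multiplied by i, 1 and -i. Hence the preimage of a chart domain is a chart domain for the same
  coordinate, and the coefficients are related by the factor k / m, where 1 / m compensates the
  scaling of the differential.\<close>

lemma sigma_aut_chart:
  assumes V: "(V, z) \<in> Sigma_atlas"
    and abc: "\<i> * a = k * a'" "- b = k * b'" "- \<i> * c = k * c'"
  defines "V' \<equiv> {q \<in> topspace Sigma_surf. sigma_aut q \<in> V}"
  shows "\<exists>m. m \<noteq> 0 \<and> (\<forall>q. z (sigma_aut q) = m * z q) \<and> (V', z) \<in> Sigma_atlas \<and>
    (\<forall>q\<in>V'. quadratic_form a b c (V, z) (sigma_aut q) = k * quadratic_form a' b' c' (V', z) q / m)"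
proof -
  have O: "openin Sigma_surf V'"
    using openin_sigma_aut_funpow_preimage[OF Sigma_atlasD(1)[OF V], of 1] by (simp add: V'_def)
  have inj: "inj_on z V'" if "\<And>q. z (sigma_aut q) = m * z q" for m
  proof (rule inj_onI)
    fix q1 q2 assume q: "q1 \<in> V'" "q2 \<in> V'" "z q1 = z q2"
    then have "sigma_aut q1 = sigma_aut q2"
      using that inj_onD[OF Sigma_atlasD(2)[OF V]] by (simp add: V'_def)
    then show "q1 = q2" by (metis sigma_aut_cubed(2))
  qed
  have k_sum: "k * (a' + b' * w + c' * w\<^sup>2) = \<i> * (a + b * (\<i> * w) + c * (\<i> * w)\<^sup>2)"
    "k * (a' * w\<^sup>2 + b' * w + c') = \<i> * (a * w\<^sup>2 + b * (\<i> * w) - c)" for w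
  proof -
    have "k * (a' + b' * w + c' * w\<^sup>2) = k * a' + k * b' * w + k * c' * w\<^sup>2"
      "k * (a' * w\<^sup>2 + b' * w + c') = k * a' * w\<^sup>2 + k * b' * w + k * c'"
      by (simp_all add: algebra_simps)
    then show "k * (a' + b' * w + c' * w\<^sup>2) = \<i> * (a + b * (\<i> * w) + c * (\<i> * w)\<^sup>2)"
      "k * (a' * w\<^sup>2 + b' * w + c') = \<i> * (a * w\<^sup>2 + b * (\<i> * w) - c)"
      unfolding abc[symmetric] by (simp_all add: algebra_simps power2_eq_square)
  qed
  \<comment> \<open>Both exponents, 7 and 3, are congruent to 3 modulo 4.\<close>
  have poly': "curve_poly' (\<i> * w) = - \<i> * curve_poly' w" for w
  proof -
    have "\<i> ^ 7 = - \<i>" "\<i> ^ 3 = - \<i>" by (simp_all add: numeral_eq_Suc)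
    then show ?thesis by (simp add: curve_poly'_def power_mult_distrib algebra_simps)
  qed
  from V show ?thesis
  proof (cases rule: Sigma_atlas_cases)
    case omega
    have m: "omega_fun (sigma_aut q) = \<i> * omega_fun q" for q by (cases q) auto
    have shape: "\<exists>w y. q = Aff w y \<and> y \<noteq> 0" if "q \<in> V'" for q
      using that omega(2) by (cases q) (auto simp: V'_def)
    have V': "(V', omega_fun) \<in> Sigma_atlas"
      by (rule Sigma_atlasI(1)[OF O inj[unfolded omega(1), OF m]]) (rule subsetI, use shape in blast)
    have "quadratic_form a b c (V, omega_fun) (sigma_aut q) =
        k * quadratic_form a' b' c' (V', omega_fun) q / \<i>" if q: "q \<in> V'" for q
    proof -
      obtain w y where wy: "q = Aff w y" "y \<noteq> 0" using shape[OF q] by blast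
      have "Aff (\<i> * w) y \<in> V" using q wy(1) by (simp add: V'_def)
      note eq = quadratic_form_omega_chart[OF V[unfolded omega(1)] this, of a b c]
        quadratic_form_omega_chart[OF V' q[unfolded wy(1)], of a' b' c']
      have "k * quadratic_form a' b' c' (V', omega_fun) (Aff w y) / \<i> =
          k * (a' + b' * w + c' * w\<^sup>2) / (y * \<i>)"
        by (simp only: eq times_divide_eq_right divide_divide_eq_left)
      also have "\<dots> = quadratic_form a b c (V, omega_fun) (Aff (\<i> * w) y)"
        unfolding k_sum(1) eq by simp
      finally show ?thesis unfolding wy(1) by simp
    qed
    then show ?thesis using m V' unfolding omega(1) by (intro exI[of _ \<i>]) auto
  next
    case y
    have m: "y_fun (sigma_aut q) = 1 * y_fun q" for q by (cases q) auto
    have shape: "\<exists>w y. q = Aff w y \<and> curve_poly' w \<noteq> 0" if "q \<in> V'" for q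
      using that y(2) by (cases q) (auto simp: V'_def poly')
    have V': "(V', y_fun) \<in> Sigma_atlas"
      by (rule Sigma_atlasI(2)[OF O inj[unfolded y(1), OF m]]) (rule subsetI, use shape in blast)
    have "quadratic_form a b c (V, y_fun) (sigma_aut q) =
        k * quadratic_form a' b' c' (V', y_fun) q / 1" if q: "q \<in> V'" for q
    proof -
      obtain w y1 where wy: "q = Aff w y1" "curve_poly' w \<noteq> 0" using shape[OF q] by blast
      have "Aff (\<i> * w) y1 \<in> V" using q wy(1) by (simp add: V'_def)
      note eq = quadratic_form_y_chart[OF V[unfolded y(1)] this, of a b c]
        quadratic_form_y_chart[OF V' q[unfolded wy(1)], of a' b' c']
      have "k * quadratic_form a' b' c' (V', y_fun) (Aff w y1) / 1 =
          2 * (k * (a' + b' * w + c' * w\<^sup>2)) / curve_poly' w"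
        by (simp only: eq) (simp add: mult.left_commute)
      also have "\<dots> = quadratic_form a b c (V, y_fun) (Aff (\<i> * w) y1)"
        unfolding k_sum(1) eq poly' using wy(2) by (simp add: divide_simps; simp add: algebra_simps)
      finally show ?thesis unfolding wy(1) by simp
    qed
    then show ?thesis using m V' unfolding y(1) by (intro exI[of _ 1]) auto
  next
    case u
    have "1 / (\<i> * w) = - \<i> * (1 / w)" for w
      by (cases "w = 0") (simp_all add: divide_simps)
    then have m: "u_fun (sigma_aut q) = - \<i> * u_fun q" for q by (cases q) simp_all
    have shape: "q \<in> {Aff w y | w y. w \<noteq> 0 \<and> y \<noteq> 0} \<union> range Infty" if "q \<in> V'" for q
      using that u(2) by (cases q) (auto simp: V'_def)
    have V': "(V', u_fun) \<in> Sigma_atlas"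
      by (rule Sigma_atlasI(3)[OF O inj[unfolded u(1), OF m]]) (rule subsetI, use shape in blast)
    have "quadratic_form a b c (V, u_fun) (sigma_aut q) =
        k * quadratic_form a' b' c' (V', u_fun) q / (- \<i>)" if q: "q \<in> V'" for q
    proof -
      obtain u1 v where uv: "q = patch_inf (u1, v)" using u_chart_point[OF V' q] by blast
      have \<sigma>q: "sigma_aut q = patch_inf (- \<i> * u1, v)" unfolding uv by (rule sigma_aut_patch_inf)
      then have "patch_inf (- \<i> * u1, v) \<in> V" using q by (simp add: V'_def)
      note eq = quadratic_form_u_chart(1)[OF V[unfolded u(1)] this, of a b c]
        quadratic_form_u_chart(1)[OF V' q[unfolded uv], of a' b' c']
      have "k * quadratic_form a' b' c' (V', u_fun) (patch_inf (u1, v)) / (- \<i>) =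
          k * (a' * u1\<^sup>2 + b' * u1 + c') / (v * \<i>)"
        by (simp only: eq times_divide_eq_right divide_divide_eq_left mult_minus_right minus_divide_divide)
      also have "\<dots> = (a * u1\<^sup>2 + b * (\<i> * u1) - c) / v"
        unfolding k_sum(2) by simp
      also have "\<dots> = quadratic_form a b c (V, u_fun) (patch_inf (- \<i> * u1, v))"
        unfolding eq by (simp add: power_mult_distrib algebra_simps)
      finally show ?thesis unfolding \<sigma>q unfolding uv by (rule sym)
    qed
    then show ?thesis using m V' unfolding u(1) by (intro exI[of _ "- \<i>"]) auto
  qed
qed

text \<open>The new domain is the image of \<open>U\<close>, written as the preimage under the
  inverse automorphism, and the new primitive is k times \<open>h\<close> composed with that
  inverse.\<close>

lemma local_primitive_sigma_aut:
  assumes abc: "\<i> * a = k * a'" "- b = k * b'" "- \<i> * c = k * c'"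
    and h: "local_primitive Sigma_surf Sigma_atlas (quadratic_form a' b' c') U h"
  shows "\<exists>U' h'. local_primitive Sigma_surf Sigma_atlas (quadratic_form a b c) U' h' \<and>
    (\<forall>p\<in>U. sigma_aut p \<in> U' \<and> h' (sigma_aut p) = k * h p)"
proof -
  define \<tau> where "\<tau> = sigma_aut ^^ 3"
  have \<tau>: "sigma_aut (\<tau> p) = p" "\<tau> (sigma_aut p) = p" for p
    unfolding \<tau>_def by (rule sigma_aut_cubed)+
  define U' where "U' = {p \<in> topspace Sigma_surf. \<tau> p \<in> U}"
  define h' where "h' p = k * h (\<tau> p)" for p
  have top: "sigma_aut p \<in> topspace Sigma_surf" "\<tau> p \<in> topspace Sigma_surf" if "p \<in> topspace Sigma_surf" for p
    using that continuous_map_sigma_aut continuous_map_sigma_aut_funpow[of 3]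
    unfolding \<tau>_def continuous_map_def by blast+
  have U: "openin Sigma_surf U" using h unfolding local_primitive_def by blast
  have "((h' \<circ> inv_into V z) has_field_derivative quadratic_form a b c (V, z) p) (at (z p))"
    if V: "(V, z) \<in> Sigma_atlas" and p: "p \<in> U'" "p \<in> V" for V z p
  proof -
    define V' where "V' = {q \<in> topspace Sigma_surf. sigma_aut q \<in> V}"
    obtain m where m: "m \<noteq> 0" "\<And>q. z (sigma_aut q) = m * z q" "(V', z) \<in> Sigma_atlas"
      "\<And>q. q \<in> V' \<Longrightarrow> quadratic_form a b c (V, z) (sigma_aut q) = k * quadratic_form a' b' c' (V', z) q / m"
      using sigma_aut_chart[OF V abc] unfolding V'_def by blast
    define q where "q = \<tau> p"
    have \<sigma>q: "sigma_aut q = p" by (simp add: q_def \<tau>(1))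
    have V_top: "V \<subseteq> topspace Sigma_surf" using Sigma_atlasD(1)[OF V] by (rule openin_subset)
    have \<tau>V: "\<tau> v \<in> V'" if "v \<in> V" for v
      using that subsetD[OF V_top that] top(2) by (simp add: V'_def \<tau>(1))
    have q: "q \<in> U" "q \<in> V'" using p \<tau>V by (simp_all add: q_def U'_def)
    have zp: "z p / m = z q" using m(1) m(2)[of q] \<sigma>q by (simp add: field_simps)
    \<comment> \<open>In coordinates the inverse automorphism is division by \<open>m\<close>, so
      differentiating \<open>h'\<close> reduces to the chain rule for a linear map.\<close>
    have inv: "h' (inv_into V z t) = k * h (inv_into V' z (t / m))" if t: "t \<in> z ` V" for t
    proof -
      define v where "v = inv_into V z t"
      have v: "v \<in> V" "z v = t" using t by (simp_all add: v_def inv_into_into f_inv_into_f)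
      have "z (\<tau> v) = t / m" using m(1) m(2)[of "\<tau> v"] v(2) by (simp add: \<tau>(1) field_simps)
      then have "inv_into V' z (t / m) = \<tau> v"
        using inv_into_f_eq[OF Sigma_atlasD(2)[OF m(3)] \<tau>V[OF v(1)]] by simp
      then show ?thesis by (simp add: h'_def flip: v_def)
    qed
    have eq: "\<forall>\<^sub>F t in nhds (z p). h' (inv_into V z t) = k * h (inv_into V' z (t / m))"
      using chart_image_nhds[OF V p(2)] by (rule eventually_mono) (rule inv)
    have "((h \<circ> inv_into V' z) has_field_derivative quadratic_form a' b' c' (V', z) q) (at (z p / m))"
      unfolding zp using h m(3) q unfolding local_primitive_def by blast
    moreover have dm: "((\<lambda>t. t / m) has_field_derivative 1 / m) (at (z p))"
      by (rule DERIV_cdivide[OF DERIV_ident])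
    ultimately have "((\<lambda>t. (h \<circ> inv_into V' z) (t / m)) has_field_derivative
        quadratic_form a' b' c' (V', z) q * (1 / m)) (at (z p))"
      by (intro DERIV_chain2[OF _ dm])
    then have "((\<lambda>t. k * h (inv_into V' z (t / m))) has_field_derivative
        k * (quadratic_form a' b' c' (V', z) q * (1 / m))) (at (z p))"
      unfolding o_def by (rule DERIV_cmult)
    also have "k * (quadratic_form a' b' c' (V', z) q * (1 / m)) = quadratic_form a b c (V, z) p"
      using m(4)[OF q(2)] \<sigma>q by simp
    finally show ?thesis unfolding o_def DERIV_cong_ev[OF refl eq refl] .
  qed
  moreover have "openin Sigma_surf U'"
    unfolding U'_def \<tau>_def by (rule openin_sigma_aut_funpow_preimage[OF U])
  ultimately have "local_primitive Sigma_surf Sigma_atlas (quadratic_form a b c) U' h'"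
    unfolding local_primitive_def by blast
  moreover have "sigma_aut p \<in> U' \<and> h' (sigma_aut p) = k * h p" if "p \<in> U" for p
    using that subsetD[OF openin_subset[OF U] that] top(1) by (simp add: U'_def h'_def \<tau>(2))
  ultimately show ?thesis by blast
qed

lemma chain_integral_sigma_aut:
  assumes "\<i> * a = k * a'" "- b = k * b'" "- \<i> * c = k * c'" and "singular_chain 1 Sigma_surf \<gamma>"
  shows "chain_integral Sigma_surf Sigma_atlas (quadratic_form a b c) (chain_map 1 sigma_aut \<gamma>) =
    k * chain_integral Sigma_surf Sigma_atlas (quadratic_form a' b' c') \<gamma>"
  by (rule chain_integral_chain_map[OF closed_form_quadratic_form closed_form_quadratic_form
        continuous_map_sigma_aut local_primitive_sigma_aut[OF assms(1-3)] assms(4)])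

section \<open>Periods and the action on homology\<close>

lemma Phi_quadratic_form:
  "Phi1 lam = quadratic_form 1 0 (- (1 + lam\<^sup>2))" "Phi2 lam = quadratic_form \<i> 0 (\<i> * (1 + lam\<^sup>2))"
  "Phi3 = quadratic_form 0 2 0" "Phi4 lam = quadratic_form 0 (2 * lam) 0"
  unfolding Phi1_def Phi2_def Phi3_def Phi4_def quadratic_form_def by (simp_all add: algebra_simps)

text \<open>The coefficient rule sends (1, 0, -(1 + \<lambda>^2)) to the coefficients of
  \<open>Phi2\<close> and those of \<open>Phi2\<close> to the negatives of the first; a pure middle
  coefficient changes sign.\<close>

lemma Re_int_sigma_aut:
  assumes "singular_chain 1 Sigma_surf \<gamma>"
  shows "Re_int (chain_map 1 sigma_aut \<gamma>) (Phi1 lam) = Re_int \<gamma> (Phi2 lam)"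
    "Re_int (chain_map 1 sigma_aut \<gamma>) (Phi2 lam) = - Re_int \<gamma> (Phi1 lam)"
    "Re_int (chain_map 1 sigma_aut \<gamma>) Phi3 = - Re_int \<gamma> Phi3"
    "Re_int (chain_map 1 sigma_aut \<gamma>) (Phi4 lam) = - Re_int \<gamma> (Phi4 lam)"
proof -
  let ?I = "\<lambda>\<Phi>. chain_integral Sigma_surf Sigma_atlas \<Phi>"
  have "?I (Phi1 lam) (chain_map 1 sigma_aut \<gamma>) = 1 * ?I (Phi2 lam) \<gamma>"
    "?I (Phi2 lam) (chain_map 1 sigma_aut \<gamma>) = - 1 * ?I (Phi1 lam) \<gamma>"
    "?I Phi3 (chain_map 1 sigma_aut \<gamma>) = - 1 * ?I Phi3 \<gamma>"
    "?I (Phi4 lam) (chain_map 1 sigma_aut \<gamma>) = - 1 * ?I (Phi4 lam) \<gamma>"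
    unfolding Phi_quadratic_form
    by (rule chain_integral_sigma_aut[OF _ _ _ assms]; simp add: algebra_simps)+
  then show "Re_int (chain_map 1 sigma_aut \<gamma>) (Phi1 lam) = Re_int \<gamma> (Phi2 lam)"
    "Re_int (chain_map 1 sigma_aut \<gamma>) (Phi2 lam) = - Re_int \<gamma> (Phi1 lam)"
    "Re_int (chain_map 1 sigma_aut \<gamma>) Phi3 = - Re_int \<gamma> Phi3"
    "Re_int (chain_map 1 sigma_aut \<gamma>) (Phi4 lam) = - Re_int \<gamma> (Phi4 lam)"
    unfolding Re_int_def by simp_all
qed

lemma period_map_homology_class:
  "period_map lam (homology_class \<gamma>) =
     vector [Re_int \<gamma> (Phi1 lam), Re_int \<gamma> (Phi2 lam), Re_int \<gamma> Phi3, Re_int \<gamma> (Phi4 lam)]"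
proof -
  have "class_integral Sigma_surf Sigma_atlas (quadratic_form a b c) (homology_class \<gamma>) =
      chain_integral Sigma_surf Sigma_atlas (quadratic_form a b c) \<gamma>" for a b c
    by (rule closed_form.class_integral_homology_class[OF closed_form_quadratic_form])
  then show ?thesis
    unfolding period_map_def Re_int_def Phi_quadratic_form by simp
qed

lemma R_map_vector:
  "R_map (vector [a, b, c, d]) = vector [b, - a, - c, - d]"
proof -
  have "(vector [a, b, c, d] :: real ^ 4) $ 1 = a" "(vector [a, b, c, d] :: real ^ 4) $ 2 = b"
    "(vector [a, b, c, d] :: real ^ 4) $ 3 = c" "(vector [a, b, c, d] :: real ^ 4) $ 4 = d"
    unfolding vector_def by simp_all
  then show ?thesis unfolding R_map_def by simp
qed

lemma H1_Sigma_cases: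
  assumes "C \<in> carrier H1_Sigma"
  obtains \<gamma> where "singular_relcycle 1 Sigma_surf {} \<gamma>" "C = homology_class \<gamma>"
  using assms unfolding carrier_relative_homology_group[of 1 Sigma_surf "{}", unfolded of_nat_1] by blast

text \<open>On a representing cycle \<gamma> the induced map is given by
  \<open>chain_map 1 sigma_aut \<gamma>\<close>, so the chain identities become one application of
  \<open>R_map\<close>.\<close>

lemma period_map_sigma_star:
  assumes "C \<in> carrier H1_Sigma"
  shows "period_map lam (sigma_star C) = R_map (period_map lam C)"
proof -
  obtain \<gamma> where \<gamma>: "singular_relcycle 1 Sigma_surf {} \<gamma>" "C = homology_class \<gamma>"
    using H1_Sigma_cases[OF assms] .
  have chain: "singular_chain 1 Sigma_surf \<gamma>" using \<gamma>(1) unfolding singular_relcycle_def by blast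
  have eq: "sigma_star C = homology_class (chain_map 1 sigma_aut \<gamma>)"
    unfolding \<gamma>(2)
    by (rule hom_induced_chain_map[OF continuous_map_sigma_aut _ \<gamma>(1), unfolded of_nat_1]) simp
  show ?thesis
    unfolding eq unfolding \<gamma>(2) period_map_homology_class R_map_vector Re_int_sigma_aut[OF chain] ..
qed

lemma sigma_star_funpow_carrier: "C \<in> carrier H1_Sigma \<Longrightarrow> (sigma_star ^^ k) C \<in> carrier H1_Sigma"
  by (induction k) (simp_all add: hom_induced_carrier)

text \<open>Functoriality turns iterates of the induced map into the map induced by an iterate, and
  the fourth iterate of the automorphism is the identity. This allows an orbit to be traversed
  backwards by forward steps.\<close>

lemma sigma_star_funpow_4:
  assumes C: "C \<in> carrier H1_Sigma"
  shows "(sigma_star ^^ (4 * k)) C = C"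
proof -
  have pow: "(sigma_star ^^ n) C = hom_induced 1 Sigma_surf {} Sigma_surf {} (sigma_aut ^^ n) C" for n
  proof (induction n)
    case 0
    show ?case using hom_induced_id[OF C] by (simp add: id_def)
  next
    case (Suc n)
    then show ?case
      using hom_induced_compose'[OF continuous_map_sigma_aut_funpow[of n] _ continuous_map_sigma_aut, of "{}" "{}" "{}" 1 C]
      by (simp add: o_def)
  qed
  have four: "(sigma_star ^^ 4) C = C"
    unfolding pow by (rule hom_induced_id_gen[OF continuous_map_sigma_aut_funpow sigma_aut_order_4 C])
  show ?thesis
  proof (induction k)
    case (Suc k)
    have "(sigma_star ^^ (4 * Suc k)) C = (sigma_star ^^ (4 * k)) ((sigma_star ^^ 4) C)"
      by (simp only: mult_Suc_right add.commute[of 4] funpow_add o_apply)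
    then show ?case using Suc four by simp
  qed simp
qed

theorem theorem10p2:
  fixes lam :: complex
  shows "(\<forall>\<gamma>. singular_relcycle 1 Sigma_surf {} \<gamma> \<longrightarrow>
            period_map lam (homology_class \<gamma>) =
              vector [Re_int \<gamma> (Phi1 lam), Re_int \<gamma> (Phi2 lam), Re_int \<gamma> Phi3, Re_int \<gamma> (Phi4 lam)])
       \<and> (\<forall>\<gamma>. singular_relcycle 1 Sigma_surf {} \<gamma> \<longrightarrow>
            Re_int (chain_map 1 sigma_aut \<gamma>) (Phi1 lam) = Re_int \<gamma> (Phi2 lam) \<and>
            Re_int (chain_map 1 sigma_aut \<gamma>) (Phi2 lam) = - Re_int \<gamma> (Phi1 lam) \<and>
            Re_int (chain_map 1 sigma_aut \<gamma>) Phi3 = - Re_int \<gamma> Phi3 \<and>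
            Re_int (chain_map 1 sigma_aut \<gamma>) (Phi4 lam) = - Re_int \<gamma> (Phi4 lam))
       \<and> (\<forall>\<Gamma> T. \<Gamma> \<subseteq> carrier H1_Sigma \<and> generate H1_Sigma \<Gamma> = carrier H1_Sigma \<and>
            sigma_star ` \<Gamma> \<subseteq> \<Gamma> \<and> orbit_representatives \<Gamma> T \<longrightarrow>
            (\<forall>C \<in> \<Gamma>. \<exists>C0 \<in> T. \<exists>k. C = (sigma_star ^^ k) C0) \<and>
            (\<forall>C \<in> \<Gamma>. \<forall>C0 \<in> T. \<forall>k. C = (sigma_star ^^ k) C0 \<longrightarrow>
               period_map lam C = (R_map ^^ k) (period_map lam C0)))"
proof (intro conjI allI impI ballI)
  fix \<gamma> assume "singular_relcycle 1 Sigma_surf {} \<gamma>"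
  then have \<gamma>: "singular_chain 1 Sigma_surf \<gamma>" unfolding singular_relcycle_def by blast
  show "period_map lam (homology_class \<gamma>) =
      vector [Re_int \<gamma> (Phi1 lam), Re_int \<gamma> (Phi2 lam), Re_int \<gamma> Phi3, Re_int \<gamma> (Phi4 lam)]"
    by (rule period_map_homology_class)
  show "Re_int (chain_map 1 sigma_aut \<gamma>) (Phi1 lam) = Re_int \<gamma> (Phi2 lam)"
    "Re_int (chain_map 1 sigma_aut \<gamma>) (Phi2 lam) = - Re_int \<gamma> (Phi1 lam)"
    "Re_int (chain_map 1 sigma_aut \<gamma>) Phi3 = - Re_int \<gamma> Phi3"
    "Re_int (chain_map 1 sigma_aut \<gamma>) (Phi4 lam) = - Re_int \<gamma> (Phi4 lam)"
    by (rule Re_int_sigma_aut[OF \<gamma>])+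
next
  fix \<Gamma> T C
  assume asm: "\<Gamma> \<subseteq> carrier H1_Sigma \<and> generate H1_Sigma \<Gamma> = carrier H1_Sigma \<and>
      sigma_star ` \<Gamma> \<subseteq> \<Gamma> \<and> orbit_representatives \<Gamma> T" and "C \<in> \<Gamma>"
  then have C: "C \<in> carrier H1_Sigma" by (meson subsetD)
  have "orbit_representatives \<Gamma> T" using asm by (elim conjE)
  with \<open>C \<in> \<Gamma>\<close> have "\<exists>!C0. C0 \<in> T \<and> C0 \<in> sigma_orbit C"
    unfolding orbit_representatives_def by (elim conjE bspec)
  then obtain C0 where C0: "C0 \<in> T" "C0 \<in> sigma_orbit C" by (elim ex1E conjE)
  from C0(2) obtain k where "C0 = (sigma_star ^^ k) C" unfolding sigma_orbit_def by auto
  \<comment> \<open>The orbit condition presents \<open>C0\<close> as an iterate of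
    \<open>C\<close>, whereas \<open>C\<close> is wanted as an iterate of \<open>C0\<close>; another
    3k steps complete 4k steps and lead back to \<open>C\<close>.\<close>
  then have "(sigma_star ^^ (3 * k)) C0 = (sigma_star ^^ (3 * k + k)) C"
    by (simp only: funpow_add o_apply)
  then have "C = (sigma_star ^^ (3 * k)) C0" using sigma_star_funpow_4[OF C, of k] by simp
  with C0(1) show "\<exists>C0\<in>T. \<exists>k. C = (sigma_star ^^ k) C0" by (intro bexI exI)
next
  fix \<Gamma> T C C0 k
  assume asm: "\<Gamma> \<subseteq> carrier H1_Sigma \<and> generate H1_Sigma \<Gamma> = carrier H1_Sigma \<and>
      sigma_star ` \<Gamma> \<subseteq> \<Gamma> \<and> orbit_representatives \<Gamma> T"
    and "C0 \<in> T" and C: "C = (sigma_star ^^ k) C0"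
  have "orbit_representatives \<Gamma> T" using asm by (elim conjE)
  then have "T \<subseteq> \<Gamma>" unfolding orbit_representatives_def by (elim conjE)
  then have C0: "C0 \<in> carrier H1_Sigma" using asm \<open>C0 \<in> T\<close> by (meson subsetD)
  show "period_map lam C = (R_map ^^ k) (period_map lam C0)"
    unfolding C by (induction k) (simp_all add: period_map_sigma_star sigma_star_funpow_carrier[OF C0])
qed

end
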